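(* Let $n\ge1$, let $H_n$ be the $(2n+1)$-dimensional Heisenberg group, let $\Gamma\subset H_n$ be any lattice and $M=H_n/\Gamma$. Then: 1. A pair of points in $M$ is blockable if and only if it is midpoint blockable. 2. Every point in $M$ is blockable away from itself. 3. The set of blockable pairs of points (in $M\times M$) is a dense countable union of closed submanifolds of positive codimension. 4. Almost all pairs of points (with respect to $\mu\times\mu$, where $\mu$ is the $H_n$-invariant probability measure on $M$) are not blockable.
   Context: $H_n=\{h_n(\vec x,\vec y,z):\vec x,\vec y\in\mathbb R^n,z\in\mathbb R\}$ where $h_n(\vec x,\vec y,z)$ is the $(n+2)\times(n+2)$ matrix with first row $(1,\vec x,z)$, middle block rows $(0,\mathrm{id}_n,\vec y)$ and last row $(0,0,1)$ ($\vec x$ a row vector, $\vec y$ a column vector). For a connected Lie group $G$ with Lie algebra $\mathfrak g$, a lattice $\Gamma$ and $M=G/\Gamma$: the connecting curves for $m_1,m_2\in M$ are $c(t)=\exp(tx)\cdot m_1$, $0\le t\le 1$, $x\in\mathfrak g$, with $c(0)=m_1,c(1)=m_2$. A finite $B\subset M\setminus\{m_1,m_2\}$ is a blocking set if every connecting curve meets $B$ on $[0,1]$; the pair is blockable (equivalently $m_1$ is blockable away from $m_2$; $m_1=m_2$ allowed) if a blocking set exists; it is midpoint blockable if $\{c(1/2)\}$ over all connecting curves is finite.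
   Formalization: Connecting curves are required to be non-constant (x ≠ 0): otherwise the constant curve at m joins m to itself and can never be blocked by a set avoiding m, so item 2 would be false; for distinct points nothing changes. *)

theory Defs
  imports "HOL-Analysis.Analysis" "HOL-Probability.Probability"
begin

text \<open>The element h_n(x,y,z) is represented by the triple (x,y,z), with x,y in R^n
  (type real^'n, n = CARD('n) >= 1) and z in R.  Matrix multiplication gives
  h(x,y,z) h(x',y',z') = h(x+x', y+y', z+z'+ x.y').\<close>

type_synonym 'n heis = "(real^'n) \<times> (real^'n) \<times> real"

definition hmul :: "'n::finite heis \<Rightarrow> 'n heis \<Rightarrow> 'n heis" where
  "hmul g h = (case g of (x,y,z) \<Rightarrow> case h of (x',y',z') \<Rightarrow> (x + x', y + y', z + z' + inner x y'))"

definition hone :: "'n::finite heis" where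
  "hone = (0, 0, 0)"

definition hinv :: "'n::finite heis \<Rightarrow> 'n heis" where
  "hinv g = (case g of (x,y,z) \<Rightarrow> (- x, - y, inner x y - z))"

text \<open>Lie algebra: strictly upper triangular matrices with first row (0,a,c) and last
  column (c,b,0), represented by the triple (a,b,c).  Since X^3 = 0 the matrix exponential
  is I + X + X^2/2, i.e. h(a, b, c + a.b/2).\<close>

definition hexp :: "'n::finite heis \<Rightarrow> 'n heis" where
  "hexp X = (case X of (a,b,c) \<Rightarrow> (a, b, c + inner a b / 2))"

definition hcoset :: "'n::finite heis set \<Rightarrow> 'n heis \<Rightarrow> 'n heis set" where
  "hcoset \<Gamma> g = hmul g ` \<Gamma>"

definition Mset :: "'n::finite heis set \<Rightarrow> 'n heis set set" where
  "Mset \<Gamma> = range (hcoset \<Gamma>)"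

definition act :: "'n::finite heis \<Rightarrow> 'n heis set \<Rightarrow> 'n heis set" where
  "act g m = hmul g ` m"

definition hsubgroup :: "'n::finite heis set \<Rightarrow> bool" where
  "hsubgroup \<Gamma> \<longleftrightarrow> hone \<in> \<Gamma> \<and> (\<forall>a\<in>\<Gamma>. \<forall>b\<in>\<Gamma>. hmul a b \<in> \<Gamma>) \<and> (\<forall>a\<in>\<Gamma>. hinv a \<in> \<Gamma>)"

text \<open>Lattice: discrete subgroup of finite covolume.  Lebesgue measure on R^(2n+1) is
  the (bi-invariant) Haar measure of H_n; finite covolume means that there is a Borel
  fundamental domain (meeting every coset g\<Gamma> in exactly one point) of finite measure.\<close>

definition lattice :: "'n::finite heis set \<Rightarrow> bool" where
  "lattice \<Gamma> \<longleftrightarrow> hsubgroup \<Gamma>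
     \<and> (\<forall>\<gamma>\<in>\<Gamma>. \<exists>e>0. ball \<gamma> e \<inter> \<Gamma> = {\<gamma>})
     \<and> (\<exists>F\<in>sets lborel. (\<forall>g. \<exists>!f. f \<in> F \<and> f \<in> hcoset \<Gamma> g) \<and> emeasure lborel F < \<infinity>)"

definition connecting :: "'n::finite heis set \<Rightarrow> 'n heis set \<Rightarrow> 'n heis \<Rightarrow> bool" where
  "connecting m1 m2 X \<longleftrightarrow> X \<noteq> 0 \<and> act (hexp X) m1 = m2"

definition blocking_set :: "'n::finite heis set \<Rightarrow> 'n heis set \<Rightarrow> 'n heis set \<Rightarrow> 'n heis set set \<Rightarrow> bool" where
  "blocking_set \<Gamma> m1 m2 B \<longleftrightarrow> finite B \<and> B \<subseteq> Mset \<Gamma> - {m1, m2}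
     \<and> (\<forall>X. connecting m1 m2 X \<longrightarrow> (\<exists>t\<in>{0..1}. act (hexp (t *\<^sub>R X)) m1 \<in> B))"

definition blockable :: "'n::finite heis set \<Rightarrow> 'n heis set \<Rightarrow> 'n heis set \<Rightarrow> bool" where
  "blockable \<Gamma> m1 m2 \<longleftrightarrow> (\<exists>B. blocking_set \<Gamma> m1 m2 B)"

definition midpoint_blockable :: "'n::finite heis set \<Rightarrow> 'n heis set \<Rightarrow> bool" where
  "midpoint_blockable m1 m2 \<longleftrightarrow> finite {act (hexp ((1/2) *\<^sub>R X)) m1 | X. connecting m1 m2 X}"

definition Mtop :: "'n::finite heis set \<Rightarrow> 'n heis set topology" where
  "Mtop \<Gamma> = topology (\<lambda>A. A \<subseteq> Mset \<Gamma> \<and> open {g. hcoset \<Gamma> g \<in> A})"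

lemma istopology_Mtop: "istopology (\<lambda>A. A \<subseteq> Mset \<Gamma> \<and> open {g. hcoset \<Gamma> g \<in> A})"
proof -
  have i: "{g. hcoset \<Gamma> g \<in> S \<inter> T} = {g. hcoset \<Gamma> g \<in> S} \<inter> {g. hcoset \<Gamma> g \<in> T}" for S T by auto
  have u: "{g. hcoset \<Gamma> g \<in> \<Union>K} = \<Union>((\<lambda>A. {g. hcoset \<Gamma> g \<in> A}) ` K)" for K by auto
  show ?thesis unfolding istopology_def i u by auto
qed

fun Ck_on :: "nat \<Rightarrow> 'a::euclidean_space set \<Rightarrow> ('a \<Rightarrow> 'b::euclidean_space) \<Rightarrow> bool" where
  "Ck_on 0 U f \<longleftrightarrow> continuous_on U f"
| "Ck_on (Suc k) U f \<longleftrightarrow> continuous_on U f \<and> f differentiable_on U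
      \<and> (\<forall>v. Ck_on k U (\<lambda>x. frechet_derivative f (at x) v))"

definition smooth_on :: "'a::euclidean_space set \<Rightarrow> ('a \<Rightarrow> 'b::euclidean_space) \<Rightarrow> bool" where
  "smooth_on U f \<longleftrightarrow> (\<forall>k. Ck_on k U f)"

text \<open>Embedded smooth submanifold of positive codimension of a Euclidean space
  (slice-chart definition: locally a diffeomorphism straightens S into a linear subspace
  of dimension < DIM, i.e. a proper subspace).\<close>

definition submanifold_pos_codim :: "'e::euclidean_space set \<Rightarrow> bool" where
  "submanifold_pos_codim S \<longleftrightarrow> (\<forall>p\<in>S. \<exists>U V L. \<exists>\<phi> \<psi> :: 'e \<Rightarrow> 'e.
      open U \<and> p \<in> U \<and> open V \<and> smooth_on U \<phi> \<and> smooth_on V \<psi>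
      \<and> \<phi> ` U = V \<and> \<psi> ` V = U \<and> (\<forall>x\<in>U. \<psi> (\<phi> x) = x) \<and> (\<forall>y\<in>V. \<phi> (\<psi> y) = y)
      \<and> subspace L \<and> L \<noteq> UNIV \<and> \<phi> ` (S \<inter> U) = V \<inter> L)"

text \<open>Closed submanifold of M\<times>M of positive codimension: closed in M\<times>M, and (the smooth
  structure of M being the one for which the covering H_n \<rightarrow> M is a local diffeomorphism)
  its preimage in H_n\<times>H_n is an embedded submanifold of positive codimension.\<close>

definition closed_submanifold_MM_pos_codim :: "'n::finite heis set \<Rightarrow> ('n heis set \<times> 'n heis set) set \<Rightarrow> bool" where
  "closed_submanifold_MM_pos_codim \<Gamma> S \<longleftrightarrow> S \<subseteq> Mset \<Gamma> \<times> Mset \<Gamma>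
     \<and> closedin (prod_topology (Mtop \<Gamma>) (Mtop \<Gamma>)) S
     \<and> submanifold_pos_codim {(g, h). (hcoset \<Gamma> g, hcoset \<Gamma> h) \<in> S}"

definition Hinv_prob :: "'n::finite heis set \<Rightarrow> 'n heis set measure \<Rightarrow> bool" where
  "Hinv_prob \<Gamma> \<mu> \<longleftrightarrow> prob_space \<mu> \<and> space \<mu> = Mset \<Gamma>
     \<and> sets \<mu> = {A. A \<subseteq> Mset \<Gamma> \<and> {g. hcoset \<Gamma> g \<in> A} \<in> sets borel}
     \<and> (\<forall>g. \<forall>A\<in>sets \<mu>. emeasure \<mu> (act g ` A) = emeasure \<mu> A)"

definition blockable_pairs :: "'n::finite heis set \<Rightarrow> ('n heis set \<times> 'n heis set) set" where
  "blockable_pairs \<Gamma> = {(m1, m2). m1 \<in> Mset \<Gamma> \<and> m2 \<in> Mset \<Gamma> \<and> blockable \<Gamma> m1 m2}"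

end

theory Submission
  imports Defs
begin

text \<open>In logarithmic coordinates \<open>(v, s)\<close> the group law is
  \<open>(v, s)(w, t) = (v + w, s + t + \<omega>(v, w) / 2)\<close> with \<open>\<omega>\<close> the standard symplectic form (\<open>wedge\<close> below),
  and one-parameter subgroups are straight lines.  Finite covolume forces the projection \<open>\<Gamma>'\<close> of the
  lattice to span \<open>\<real>\<^sup>2\<^sup>n\<close>; hence the centre of \<open>\<Gamma>\<close> is \<open>\<delta>\<int>\<close> with \<open>\<delta> > 0\<close>, and \<open>\<omega>(\<Gamma>', \<Gamma>') \<subseteq> \<delta>\<int>\<close>.
  The pair \<open>(g\<Gamma>, h\<Gamma>)\<close> is blockable, equivalently midpoint blockable, iff the difference \<open>v\<close> of the
  projections of \<open>h\<close> and \<open>g\<close> satisfies \<open>\<omega>(v, \<lambda>) \<in> \<rat>\<delta>\<close> for all \<open>\<lambda> \<in> \<Gamma>'\<close>.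
  These \<open>v\<close> form a countable dense subgroup containing \<open>\<Gamma>'\<close>, so the blockable pairs
  form a countable union of preimages of translates of the discrete group \<open>\<Gamma>'\<close>.\<close>

text \<open>Why rationality decides: replacing the endpoint over \<open>v + u\<close> by one over
  \<open>v + u + 2 \<mu>\<close>, with \<mu> in \<Gamma>', shifts the midpoint by \<mu>. Right
  translation by \<Gamma> undoes this shift up to a central error, in which
  \<open>wedge v \<mu> / 4\<close> is the only term that is not automatically a multiple of \<delta>
  / 4. Rational pairings leave finitely many errors modulo \<delta>. The converse is harder, since a
  blocking set may use any time and not just 1/2. The irrational pairing itself helps: on all curves
  to \<open>g \<gamma>^k\<close>, with \<gamma> over u, the quantity
  \<open>wedge _ u / \<delta>\<close> at time t is t times the same nonzero slope, so a blocking
  point admits only finitely many times. Pigeonhole then applies to pairs of a point and a time. Two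
  facts about \<Gamma>' are not automatic. Finite covolume is given by a Borel fundamental domain,
  not by compactness, so spanning needs a measure argument. And the projection of a discrete group
  may fail to be discrete; here it is discrete because the symplectic form takes values in \<delta>
  times the integers on a spanning set.\<close>

section \<open>The Heisenberg group in logarithmic coordinates\<close>

definition hproj :: "'n::finite heis \<Rightarrow> (real^'n) \<times> (real^'n)" where
  "hproj g = (fst g, fst (snd g))"

definition wedge :: "(real^'n::finite) \<times> (real^'n) \<Rightarrow> (real^'n) \<times> (real^'n) \<Rightarrow> real" where
  "wedge u v = inner (fst u) (snd v) - inner (snd u) (fst v)"

definition hel :: "(real^'n::finite) \<times> (real^'n) \<Rightarrow> real \<Rightarrow> 'n heis" where
  "hel v s = hexp (fst v, snd v, s)"

lemma wedge_simps [simp]: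
  "wedge (u + v) w = wedge u w + wedge v w" "wedge w (u + v) = wedge w u + wedge w v"
  "wedge (u - v) w = wedge u w - wedge v w" "wedge w (u - v) = wedge w u - wedge w v"
  "wedge (- u) w = - wedge u w" "wedge w (- u) = - wedge w u"
  "wedge (c *\<^sub>R u) w = c * wedge u w" "wedge w (c *\<^sub>R u) = c * wedge w u"
  "wedge 0 w = 0" "wedge w 0 = 0" "wedge u u = 0"
  by (auto simp: wedge_def inner_add inner_diff algebra_simps inner_commute)

lemma wedge_sum_right: "wedge w (\<Sum>i\<in>I. f i) = (\<Sum>i\<in>I. wedge w (f i))"
  by (induction I rule: infinite_finite_induct) auto

lemma wedge_skew: "wedge u v = - wedge v u"
  by (simp add: wedge_def inner_commute)

lemma wedge_eq_inner: "wedge u v = inner (- snd u, fst u) v"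
  by (cases v) (simp add: wedge_def)

lemma abs_wedge_le: "\<bar>wedge u v\<bar> \<le> norm u * norm v"
proof -
  have "norm (- snd u, fst u) = norm u"
    by (cases u) (simp add: norm_Pair add.commute)
  then show ?thesis
    unfolding wedge_eq_inner using Cauchy_Schwarz_ineq2[of "(- snd u, fst u)" v] by simp
qed

text \<open>Nondegeneracy of the symplectic form: pairing u with its rotation
  \<open>(- snd u, fst u)\<close> gives the squared norm.\<close>

lemma wedge_eq_0_span:
  assumes "span B = UNIV" "\<And>b. b \<in> B \<Longrightarrow> wedge u b = 0"
  shows "u = 0"
proof -
  have "wedge u w = 0" for w
  proof -
    have "w \<in> span B" using assms by auto
    then show ?thesis
      by (induction rule: span_induct_alt) (auto simp: assms)
  qed
  from this[of "(- snd u, fst u)"] have "(- snd u, fst u) = 0"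
    unfolding wedge_eq_inner using inner_eq_zero_iff by blast
  then show ?thesis by (cases u) (auto simp: zero_prod_def)
qed

lemma hel_mult: "hmul (hel v s) (hel w t) = hel (v + w) (s + t + wedge v w / 2)"
  by (simp add: hmul_def hel_def hexp_def wedge_def inner_add field_simps inner_commute)

lemma hel_inv: "hinv (hel v s) = hel (- v) (- s)"
  by (simp add: hinv_def hel_def hexp_def field_simps)

lemma hone_hel: "hone = hel 0 0"
  by (simp add: hone_def hel_def hexp_def)

lemma hel_inject [simp]: "hel v s = hel w t \<longleftrightarrow> v = w \<and> s = t"
  by (auto simp: hel_def hexp_def prod_eq_iff)

lemma hproj_hel [simp]: "hproj (hel v s) = v"
  by (simp add: hproj_def hel_def hexp_def)

lemma hel_cases: obtains v s where "g = hel v s"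
proof -
  obtain x y z where "g = (x, y, z)" by (metis prod.exhaust)
  then have "g = hel (x, y) (z - inner x y / 2)"
    by (simp add: hel_def hexp_def)
  then show thesis using that by blast
qed

lemma hexp_scale: "hexp (t *\<^sub>R (fst v, snd v, s)) = hel (t *\<^sub>R v) (t * s)"
  by (simp add: hel_def)

lemma hmul_assoc: "hmul (hmul a b) c = hmul a (hmul b c)"
  by (cases a rule: hel_cases; cases b rule: hel_cases; cases c rule: hel_cases)
    (simp add: hel_mult field_simps)

lemma hmul_hone [simp]: "hmul g hone = g" "hmul hone g = g"
  by (cases g rule: hel_cases; simp add: hone_hel hel_mult)+

lemma hmul_hinv [simp]: "hmul g (hinv g) = hone" "hmul (hinv g) g = hone"
  by (cases g rule: hel_cases; simp add: hone_hel hel_mult hel_inv)+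

lemma hmul_hinv_cancel [simp]:
  "hmul g (hmul (hinv g) h) = h" "hmul (hinv g) (hmul g h) = h"
  by (simp_all flip: hmul_assoc)

lemma hproj_hmul [simp]: "hproj (hmul g h) = hproj g + hproj h"
  by (cases g rule: hel_cases; cases h rule: hel_cases) (simp add: hel_mult)

lemma hproj_hinv [simp]: "hproj (hinv g) = - hproj g"
  by (cases g rule: hel_cases) (simp add: hel_inv)

lemma continuous_on_hproj [continuous_intros]: "continuous_on S hproj"
  unfolding hproj_def by (intro continuous_intros)

lemma continuous_on_wedge_left [continuous_intros]:
  "continuous_on S f \<Longrightarrow> continuous_on S (\<lambda>x. wedge (f x) w)"
  unfolding wedge_def by (intro continuous_intros)

lemma continuous_on_hmul:
  "continuous_on S (\<lambda>g. hmul g a)" "continuous_on S (hmul a)"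
  unfolding hmul_def case_prod_unfold by (intro continuous_intros)+

lemma hcoset_memI: "\<gamma> \<in> \<Gamma> \<Longrightarrow> hmul g \<gamma> \<in> hcoset \<Gamma> g"
  by (simp add: hcoset_def)

lemma act_hcoset [simp]: "act a (hcoset \<Gamma> g) = hcoset \<Gamma> (hmul a g)"
  by (simp add: act_def hcoset_def image_image hmul_assoc)

lemma act_act [simp]: "act a (act b m) = act (hmul a b) m"
  by (simp add: act_def image_image hmul_assoc)

lemma act_hone [simp]: "act hone m = m"
  by (simp add: act_def)

lemma act_eq_iff [simp]: "act a m = act a m' \<longleftrightarrow> m = m'"
  by (metis act_act act_hone hmul_hinv(2))

lemma hcoset_in_Mset [simp]: "hcoset \<Gamma> g \<in> Mset \<Gamma>"
  by (simp add: Mset_def)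

lemma Mset_cases: assumes "m \<in> Mset \<Gamma>" obtains g where "m = hcoset \<Gamma> g"
  using assms by (auto simp: Mset_def)

lemma act_in_Mset [simp]: "act a m \<in> Mset \<Gamma> \<longleftrightarrow> m \<in> Mset \<Gamma>"
proof
  assume "act a m \<in> Mset \<Gamma>"
  then obtain g where "act a m = hcoset \<Gamma> g" by (rule Mset_cases)
  then have "act (hinv a) (act a m) = hcoset \<Gamma> (hmul (hinv a) g)" by simp
  then show "m \<in> Mset \<Gamma>" by simp
qed (auto elim!: Mset_cases)

lemma hcoset_eq_iff:
  assumes "hsubgroup \<Gamma>"
  shows "hcoset \<Gamma> g = hcoset \<Gamma> h \<longleftrightarrow> (\<exists>\<gamma>\<in>\<Gamma>. h = hmul g \<gamma>)"
proof
  assume eq: "hcoset \<Gamma> g = hcoset \<Gamma> h"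
  have "hmul h hone \<in> hcoset \<Gamma> h"
    using assms hcoset_memI hsubgroup_def by blast
  with eq show "\<exists>\<gamma>\<in>\<Gamma>. h = hmul g \<gamma>" by (auto simp: hcoset_def)
next
  assume "\<exists>\<gamma>\<in>\<Gamma>. h = hmul g \<gamma>"
  then obtain \<gamma> where \<gamma>: "\<gamma> \<in> \<Gamma>" "h = hmul g \<gamma>" by blast
  have "\<gamma>' \<in> hmul \<gamma> ` \<Gamma>" if "\<gamma>' \<in> \<Gamma>" for \<gamma>'
    using that \<gamma> assms by (intro image_eqI[of _ _ "hmul (hinv \<gamma>) \<gamma>'"]) (auto simp: hsubgroup_def)
  then have "hmul \<gamma> ` \<Gamma> = \<Gamma>"
    using assms \<gamma> by (auto simp: hsubgroup_def)
  then show "hcoset \<Gamma> g = hcoset \<Gamma> h"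
    using \<gamma> by (metis act_def act_hcoset hcoset_def)
qed

section \<open>Haar measure and the span of a lattice\<close>

lemma borel_measurable_hmul [measurable]:
  "(\<lambda>g. hmul g a) \<in> borel_measurable borel" "hmul a \<in> borel_measurable borel"
  by (intro borel_measurable_continuous_onI continuous_on_hmul)+

lemma nn_integral_lborel_plus:
  fixes c :: "'a::euclidean_space"
  assumes "f \<in> borel_measurable borel"
  shows "(\<integral>\<^sup>+x. f (c + x) \<partial>lborel) = (\<integral>\<^sup>+x. f x \<partial>lborel)"
proof -
  have "(\<integral>\<^sup>+x. f x \<partial>lborel) = (\<integral>\<^sup>+x. f x \<partial>distr lborel borel ((+) c))"
    by (simp add: lborel_distr_plus)
  also have "\<dots> = (\<integral>\<^sup>+x. f (c + x) \<partial>lborel)"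
    using assms by (subst nn_integral_distr) auto
  finally show ?thesis by simp
qed

lemma nn_integral_lborel_iterated:
  fixes f :: "'a::euclidean_space \<times> 'b::euclidean_space \<Rightarrow> ennreal"
  assumes "f \<in> borel_measurable borel"
  shows "(\<integral>\<^sup>+p. f p \<partial>lborel) = (\<integral>\<^sup>+x. \<integral>\<^sup>+y. f (x, y) \<partial>lborel \<partial>lborel)"
proof -
  have "f \<in> borel_measurable (lborel \<Otimes>\<^sub>M lborel)"
    using assms by (simp add: lborel_prod)
  from lborel.nn_integral_fst[OF this] show ?thesis
    by (simp add: lborel_prod)
qed

text \<open>Common form of left and right translations in matrix coordinates: constants are added to
  x and y, and a function of (x, y) to z. In the iterated integral the inner z-integral absorbs that
  function for fixed x and y, and an ordinary translation remains.\<close>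

lemma emeasure_lborel_shear:
  fixes l :: "'a::euclidean_space \<times> 'b::euclidean_space \<Rightarrow> 'c::euclidean_space"
  assumes [measurable]: "A \<in> sets borel" "l \<in> borel_measurable borel"
  shows "emeasure lborel {(x, y, z). (p + x, q + y, l (x, y) + z) \<in> A} = emeasure lborel A"
    (is "emeasure _ ?S = _")
proof -
  let ?I = "indicator A :: 'a \<times> 'b \<times> 'c \<Rightarrow> ennreal"
  have T [measurable]: "(\<lambda>(x, y, z). (p + x, q + y, l (x, y) + z)) \<in> borel_measurable borel"
  proof -
    have 1: "(\<lambda>w::'a \<times> 'b \<times> 'c. l (fst w, fst (snd w))) \<in> borel_measurable borel"
      by (rule measurable_compose[OF borel_measurable_continuous_onI assms(2)])
        (intro continuous_intros)
    have 2: "(\<lambda>w::'a \<times> 'b \<times> 'c. p + fst w) \<in> borel_measurable borel"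
      "(\<lambda>w::'a \<times> 'b \<times> 'c. q + fst (snd w)) \<in> borel_measurable borel"
      "(\<lambda>w::'a \<times> 'b \<times> 'c. snd (snd w)) \<in> borel_measurable borel"
      by (intro borel_measurable_continuous_onI continuous_intros)+
    show ?thesis
      unfolding case_prod_unfold by (intro borel_measurable_Pair borel_measurable_add[OF 1] 2)
  qed
  have m: "(\<lambda>w. ?I ((\<lambda>(x, y, z). (p + x, q + y, l (x, y) + z)) w)) \<in> borel_measurable borel"
    by (rule measurable_compose[OF T]) simp
  have S: "?S \<in> sets borel"
  proof -
    have "?S = (\<lambda>(x, y, z). (p + x, q + y, l (x, y) + z)) -` A \<inter> space borel"
      by auto
    then show ?thesis using measurable_sets[OF T, of A] by simp
  qed
  have iter3: "(\<integral>\<^sup>+w. f w \<partial>lborel) = (\<integral>\<^sup>+x. \<integral>\<^sup>+y. \<integral>\<^sup>+z. f (x, y, z) \<partial>lborel \<partial>lborel \<partial>lborel)"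
    if f: "f \<in> borel_measurable borel" for f :: "'a \<times> 'b \<times> 'c \<Rightarrow> ennreal"
  proof -
    have "(\<lambda>w. f (x, w)) \<in> borel_measurable borel" for x
      by (rule measurable_compose[OF borel_measurable_continuous_onI f])
        (intro continuous_intros)
    then show ?thesis
      unfolding nn_integral_lborel_iterated[OF f]
      by (intro nn_integral_cong nn_integral_lborel_iterated)
  qed
  have "emeasure lborel ?S = (\<integral>\<^sup>+w. indicator ?S w \<partial>lborel)"
    using S by simp
  also have "\<dots> = (\<integral>\<^sup>+w. ?I ((\<lambda>(x, y, z). (p + x, q + y, l (x, y) + z)) w) \<partial>lborel)"
    by (intro nn_integral_cong) (auto simp: indicator_def)
  also have "\<dots> = (\<integral>\<^sup>+x. \<integral>\<^sup>+y. \<integral>\<^sup>+z. ?I (p + x, q + y, l (x, y) + z) \<partial>lborel \<partial>lborel \<partial>lborel)"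
    by (subst iter3[OF m]) simp
  also have "\<dots> = (\<integral>\<^sup>+x. \<integral>\<^sup>+y. \<integral>\<^sup>+z. ?I (p + x, q + y, z) \<partial>lborel \<partial>lborel \<partial>lborel)"
  proof (rule nn_integral_cong, rule nn_integral_cong)
    fix x y
    have "(\<lambda>z. ?I (p + x, q + y, z)) \<in> borel_measurable borel"
      by (rule measurable_compose[OF borel_measurable_continuous_onI borel_measurable_indicator])
        (intro continuous_intros, rule assms)
    from nn_integral_lborel_plus[OF this]
    show "(\<integral>\<^sup>+z. ?I (p + x, q + y, l (x, y) + z) \<partial>lborel) = (\<integral>\<^sup>+z. ?I (p + x, q + y, z) \<partial>lborel)" .
  qed
  also have "\<dots> = (\<integral>\<^sup>+w. ?I ((p, q, 0) + w) \<partial>lborel)"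
  proof -
    have "(\<lambda>w. ?I ((p, q, 0) + w)) \<in> borel_measurable borel"
      by (rule measurable_compose[where N=borel]) auto
    from iter3[OF this] show ?thesis by (simp only: add_Pair add_0)
  qed
  also have "\<dots> = (\<integral>\<^sup>+w. ?I w \<partial>lborel)"
    by (rule nn_integral_lborel_plus) simp
  also have "\<dots> = emeasure lborel A" by simp
  finally show ?thesis .
qed


lemma emeasure_lborel_hmul:
  assumes "A \<in> sets borel"
  shows "emeasure lborel {g. hmul g a \<in> A} = emeasure lborel A"
    and "emeasure lborel {g. hmul a g \<in> A} = emeasure lborel A"
proof -
  obtain p q r where a: "a = (p, q, r)" by (metis prod.exhaust)
  have "{g. hmul g a \<in> A} = {(x, y, z). (p + x, q + y, (r + inner x q) + z) \<in> A}"
    by (auto simp: hmul_def a add_ac)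
  moreover have "(\<lambda>(x, y). r + inner x q) \<in> borel_measurable borel"
    unfolding case_prod_unfold by (intro borel_measurable_continuous_onI continuous_intros)
  ultimately show "emeasure lborel {g. hmul g a \<in> A} = emeasure lborel A"
    using emeasure_lborel_shear[OF assms, of "\<lambda>(x, y). r + inner x q" p q] by simp
  have "{g. hmul a g \<in> A} = {(x, y, z). (p + x, q + y, (r + inner p y) + z) \<in> A}"
    by (auto simp: hmul_def a add_ac)
  moreover have "(\<lambda>(x::real^'a, y). r + inner p y) \<in> borel_measurable borel"
    unfolding case_prod_unfold by (intro borel_measurable_continuous_onI continuous_intros)
  ultimately show "emeasure lborel {g. hmul a g \<in> A} = emeasure lborel A"
    using emeasure_lborel_shear[OF assms, of "\<lambda>(x, y). r + inner p y" p q] by simp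
qed

lemma sets_borel_vimage_hmul:
  assumes "A \<in> sets borel"
  shows "{g. hmul g a \<in> A} \<in> sets borel" "{g. hmul a g \<in> A} \<in> sets borel"
  using measurable_sets[OF borel_measurable_hmul(1) assms, of a]
    measurable_sets[OF borel_measurable_hmul(2) assms, of a]
  by (simp_all add: vimage_def)

lemma countable_isolated_points:
  fixes S :: "'a::{metric_space, second_countable_topology} set"
  assumes "\<And>x. x \<in> S \<Longrightarrow> \<exists>e>0. ball x e \<inter> S = {x}"
  shows "countable S"
proof -
  obtain \<B> :: "'a set set" where \<B>: "countable \<B>" "topological_basis \<B>"
    using ex_countable_basis by blast
  have "\<exists>b\<in>\<B>. b \<inter> S = {x}" if "x \<in> S" for x
  proof -
    obtain e where e: "e > 0" "ball x e \<inter> S = {x}" using assms \<open>x \<in> S\<close> by blast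
    obtain b where "b \<in> \<B>" "x \<in> b" "b \<subseteq> ball x e"
      using topological_basisE[OF \<B>(2), of "ball x e" x] e by auto
    with e that show ?thesis by (intro bexI[of _ b]) auto
  qed
  then obtain f where f: "\<And>x. x \<in> S \<Longrightarrow> f x \<in> \<B> \<and> f x \<inter> S = {x}" by metis
  then have "inj_on f S" by (intro inj_onI) (metis singleton_inject)
  moreover have "countable (f ` S)" using f \<B>(1) by (meson countable_subset image_subsetI)
  ultimately show ?thesis by (rule countable_image_inj_on[rotated])
qed

text \<open>Uniqueness is put on the lattice element instead of on the point of the coset, as in
  \<open>lattice\<close>. The group then splits into translates of F indexed by \<Gamma>, over which
  measures can be summed.\<close>

definition fundamental_domain :: "'n::finite heis set \<Rightarrow> 'n heis set \<Rightarrow> bool" where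
  "fundamental_domain \<Gamma> F \<longleftrightarrow> F \<in> sets borel \<and> (\<forall>g. \<exists>!\<gamma>. \<gamma> \<in> \<Gamma> \<and> hmul g \<gamma> \<in> F)"

lemma emeasure_fundamental_domain:
  assumes F: "fundamental_domain \<Gamma> F" and "countable \<Gamma>" and E [measurable]: "E \<in> sets borel"
  shows "emeasure lborel E = (\<integral>\<^sup>+\<gamma>. emeasure lborel (E \<inter> {g. hmul g \<gamma> \<in> F}) \<partial>count_space \<Gamma>)"
proof -
  let ?X = "\<lambda>\<gamma>. E \<inter> {g. hmul g \<gamma> \<in> F}"
  have "\<exists>\<gamma>\<in>\<Gamma>. hmul g \<gamma> \<in> F" for g
    using F unfolding fundamental_domain_def by blast
  then have "E = \<Union>(?X ` \<Gamma>)" by blast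
  moreover have "\<gamma> = \<gamma>'" if "\<gamma> \<in> \<Gamma>" "\<gamma>' \<in> \<Gamma>" "hmul g \<gamma> \<in> F" "hmul g \<gamma>' \<in> F" for g \<gamma> \<gamma>'
    using F that unfolding fundamental_domain_def by blast
  then have "disjoint_family_on ?X \<Gamma>"
    unfolding disjoint_family_on_def by blast
  moreover have "?X \<gamma> \<in> sets lborel" for \<gamma>
    using F E sets_borel_vimage_hmul(1)[of F] by (simp add: fundamental_domain_def)
  ultimately show ?thesis
    using emeasure_UN_countable[of \<Gamma> ?X lborel] \<open>countable \<Gamma>\<close> by simp
qed

text \<open>Unfolding: the part of \<open>F' \<inter> E\<close> that \<gamma> carries into F is
  moved by \<gamma>, without change of measure, onto the part of \<open>F \<inter> E\<close> that
  \<open>hinv \<gamma>\<close> carries into F'. Summing over \<Gamma> gives both sides.\<close>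

lemma emeasure_fundamental_domain_Int_eq:
  assumes \<Gamma>: "hsubgroup \<Gamma>" "countable \<Gamma>"
    and F: "fundamental_domain \<Gamma> F" and F': "fundamental_domain \<Gamma> F'"
    and E: "E \<in> sets borel" and inv: "\<And>g \<gamma>. \<gamma> \<in> \<Gamma> \<Longrightarrow> hmul g \<gamma> \<in> E \<longleftrightarrow> g \<in> E"
  shows "emeasure lborel (F \<inter> E) = emeasure lborel (F' \<inter> E)"
proof -
  have F'inv: "fundamental_domain (hinv ` \<Gamma>) F'"
  proof -
    have "hinv ` \<Gamma> = \<Gamma>"
    proof -
      have "hinv (hinv g) = g" for g :: "'a heis"
        by (cases g rule: hel_cases) (simp add: hel_inv)
      moreover have "hinv \<gamma> \<in> \<Gamma>" if "\<gamma> \<in> \<Gamma>" for \<gamma>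
        using \<Gamma>(1) that by (simp add: hsubgroup_def)
      ultimately show ?thesis by (intro subset_antisym image_subsetI subsetI) (metis image_eqI)+
    qed
    then show ?thesis using F' by simp
  qed
  have inj: "inj_on hinv \<Gamma>"
    by (rule inj_on_inverseI[of _ hinv]) (auto simp: hinv_def inner_commute)
  have borel: "F \<in> sets borel" "F' \<in> sets borel"
    using F F' by (auto simp: fundamental_domain_def)
  have "emeasure lborel (F' \<inter> E) =
      (\<integral>\<^sup>+\<gamma>. emeasure lborel (F' \<inter> E \<inter> {g. hmul g \<gamma> \<in> F}) \<partial>count_space \<Gamma>)"
    using borel E by (intro emeasure_fundamental_domain F \<Gamma>) auto
  also have "\<dots> = (\<integral>\<^sup>+\<gamma>. emeasure lborel (F \<inter> E \<inter> {g. hmul g (hinv \<gamma>) \<in> F'}) \<partial>count_space \<Gamma>)"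
  proof (rule nn_integral_cong)
    fix \<gamma> assume "\<gamma> \<in> space (count_space \<Gamma>)"
    then have \<gamma>: "\<gamma> \<in> \<Gamma>" by simp
    let ?A = "F \<inter> E \<inter> {g. hmul g (hinv \<gamma>) \<in> F'}"
    have "F' \<inter> E \<inter> {g. hmul g \<gamma> \<in> F} = {g. hmul g \<gamma> \<in> ?A}"
      using inv[OF \<gamma>] by (auto simp: hmul_assoc)
    moreover have "?A \<in> sets borel"
      using borel E sets_borel_vimage_hmul(1)[of F'] by auto
    ultimately show "emeasure lborel (F' \<inter> E \<inter> {g. hmul g \<gamma> \<in> F}) = emeasure lborel ?A"
      using emeasure_lborel_hmul(1)[of ?A \<gamma>] by simp
  qed
  also have "\<dots> = (\<integral>\<^sup>+\<gamma>. emeasure lborel (F \<inter> E \<inter> {g. hmul g \<gamma> \<in> F'}) \<partial>count_space (hinv ` \<Gamma>))"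
    using inj by (intro nn_integral_bij_count_space) (simp add: bij_betw_def)
  also have "\<dots> = emeasure lborel (F \<inter> E)"
    using borel E \<Gamma> by (intro emeasure_fundamental_domain[symmetric] F'inv) auto
  finally show ?thesis by simp
qed

text \<open>Serves twice: for the slabs of a fundamental domain and for the fibres of a character on
  the nilmanifold.\<close>

lemma infinite_disjoint_emeasure_eq_0:
  assumes "infinite I" "countable I" "disjoint_family_on X I"
    and X: "\<And>i. i \<in> I \<Longrightarrow> X i \<in> sets M" "\<And>i. i \<in> I \<Longrightarrow> emeasure M (X i) = c"
    and "emeasure M (\<Union>(X ` I)) < \<infinity>"
  shows "c = 0"
proof (rule ccontr)
  assume "c \<noteq> 0"
  have "emeasure M (\<Union>(X ` I)) = (\<integral>\<^sup>+i. emeasure M (X i) \<partial>count_space I)"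
    using assms by (intro emeasure_UN_countable)
  also have "\<dots> = (\<integral>\<^sup>+i. c \<partial>count_space I)"
    using X by (intro nn_integral_cong) simp
  also have "\<dots> = \<infinity>"
    using \<open>c \<noteq> 0\<close> \<open>infinite I\<close> by (simp add: ennreal_mult_top top_unique ennreal_mult_eq_top_iff)
  finally show False using assms by simp
qed

text \<open>A linear functional vanishing on the projection of the lattice would cut a fundamental domain
  into infinitely many slabs of equal measure.\<close>

lemma span_hproj_lattice:
  assumes "lattice \<Gamma>"
  shows "span (hproj ` \<Gamma>) = UNIV"
proof (rule ccontr)
  assume "span (hproj ` \<Gamma>) \<noteq> UNIV"
  then obtain a where a: "a \<noteq> 0" "\<And>x. x \<in> span (hproj ` \<Gamma>) \<Longrightarrow> inner a x = 0"
    using span_not_univ_subset_hyperplane by blast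
  have \<Gamma>: "hsubgroup \<Gamma>" "countable \<Gamma>"
    using assms countable_isolated_points[of \<Gamma>] by (auto simp: lattice_def)
  obtain F where F: "F \<in> sets borel" "\<And>g. \<exists>!f. f \<in> F \<and> f \<in> hcoset \<Gamma> g" "emeasure lborel F < \<infinity>"
    using assms by (auto simp: lattice_def)
  have inj: "\<gamma> = \<gamma>'" if "hmul g \<gamma> = hmul g \<gamma>'" for g \<gamma> \<gamma>' :: "'a heis"
    using that by (metis hmul_hinv_cancel(2))
  have FD: "fundamental_domain \<Gamma> F"
    unfolding fundamental_domain_def
  proof (intro conjI allI F)
    fix g
    show "\<exists>!\<gamma>. \<gamma> \<in> \<Gamma> \<and> hmul g \<gamma> \<in> F"
      using F(2)[of g] inj[of g] unfolding hcoset_def by blast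
  qed
  define E where "E j = {g. \<lfloor>inner a (hproj g)\<rfloor> = j}" for j
  \<comment> \<open>Left translation by \<open>h j\<close> raises the coordinate
    \<open>inner a (hproj g)\<close> by exactly j, so it carries slab 0 onto slab j.\<close>
  define h where "h j = hel ((of_int j / inner a a) *\<^sub>R a) 0" for j
  have E: "E j \<in> sets borel" for j
  proof -
    have [measurable]: "(\<lambda>g. inner a (hproj g)) \<in> borel_measurable borel"
      by (intro borel_measurable_continuous_onI continuous_intros)
    show ?thesis unfolding E_def by measurable
  qed
  have eq: "emeasure lborel (F \<inter> E j) = emeasure lborel (F \<inter> E 0)" for j
  proof -
    \<comment> \<open>Left translates of a fundamental domain are again fundamental domains, because
      left multiplication commutes with the right action of \<Gamma>. The slabs are invariant under
      that action because a is orthogonal to \<Gamma>'.\<close>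
    have "fundamental_domain \<Gamma> {g. hmul (h j) g \<in> F}"
      using FD sets_borel_vimage_hmul(2)[of F]
      by (simp add: fundamental_domain_def del: split_paired_All split_paired_Ex flip: hmul_assoc)
    then have "emeasure lborel (F \<inter> E 0) = emeasure lborel ({g. hmul (h j) g \<in> F} \<inter> E 0)"
      by (intro emeasure_fundamental_domain_Int_eq[OF \<Gamma> FD _ E])
        (auto simp: E_def inner_add_right a span_base)
    also have "{g. hmul (h j) g \<in> F} \<inter> E 0 = {g. hmul (h j) g \<in> F \<inter> E j}"
      using a(1) by (auto simp: E_def h_def inner_add_right)
    also have "emeasure lborel \<dots> = emeasure lborel (F \<inter> E j)"
      using F(1) E by (intro emeasure_lborel_hmul) auto
    finally show ?thesis by simp
  qed
  have UN: "(\<Union>j. F \<inter> E j) = F" by (auto simp: E_def)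
  have "emeasure lborel (F \<inter> E 0) = 0"
    by (rule infinite_disjoint_emeasure_eq_0[of UNIV "\<lambda>j. F \<inter> E j" lborel])
      (use F E eq UN in \<open>auto simp: disjoint_family_on_def E_def infinite_UNIV_int\<close>)
  then have "emeasure lborel (\<Union>j. F \<inter> E j) = 0"
    using F E eq by (subst emeasure_UN_countable) (auto simp: disjoint_family_on_def E_def)
  then have "emeasure lborel F = 0" using UN by simp
  \<comment> \<open>The whole group is a countable union of right translates of the null set
    F.\<close>
  then have "emeasure lborel (UNIV :: 'a heis set) = 0"
    using emeasure_lborel_hmul(1)[OF F(1)]
    by (subst emeasure_fundamental_domain[OF FD \<Gamma>(2)]) auto
  then show False by simp
qed

section \<open>Lattices with a marked centre and a finite spanning set\<close>

text \<open>The generator is the least positive element. Division with remainder by it leaves a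
  remainder in C below the least positive element, hence 0.\<close>

lemma discrete_subgroup_real_cyclic:
  fixes C :: "real set"
  assumes diff: "\<And>x y. x \<in> C \<Longrightarrow> y \<in> C \<Longrightarrow> x - y \<in> C"
    and "e > 0" and disc: "\<And>x. x \<in> C \<Longrightarrow> \<bar>x\<bar> < e \<Longrightarrow> x = 0"
    and "x0 \<in> C" "x0 \<noteq> 0"
  shows "\<exists>\<delta>>0. \<forall>c. c \<in> C \<longleftrightarrow> c / \<delta> \<in> \<int>"
proof -
  have zero: "0 \<in> C" using diff[OF \<open>x0 \<in> C\<close> \<open>x0 \<in> C\<close>] by simp
  have neg: "- x \<in> C" if "x \<in> C" for x using diff[OF zero that] by simp
  have add: "x + y \<in> C" if "x \<in> C" "y \<in> C" for x y using diff[OF that(1) neg[OF that(2)]] by simp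
  have nat_mult: "of_nat n * x \<in> C" if "x \<in> C" for n x
    by (induction n) (use zero add that in \<open>auto simp: algebra_simps\<close>)
  have int_mult: "of_int k * x \<in> C" if "x \<in> C" for k x
    using nat_mult[OF that] neg[OF nat_mult[OF that]] by (cases k rule: int_cases2) auto
  define P where "P = {c \<in> C. c > 0}"
  have "\<bar>x0\<bar> \<in> P" using assms neg[OF \<open>x0 \<in> C\<close>] by (auto simp: P_def abs_if)
  then have ne: "P \<noteq> {}" by auto
  have lb: "e \<le> c" if "c \<in> P" for c
    using disc[of c] that by (force simp: P_def)
  then have bdd: "bdd_below P" by (meson bdd_belowI)
  define \<delta> where "\<delta> = Inf P"
  have "\<delta> \<ge> e" unfolding \<delta>_def using lb by (intro cInf_greatest ne)
  then have pos: "\<delta> > 0" using \<open>e > 0\<close> by simp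
  have low: "\<delta> \<le> c" if "c \<in> P" for c unfolding \<delta>_def using that bdd by (rule cInf_lower)
  \<comment> \<open>If the infimum were not attained, two distinct positive elements would lie
    within e above it, and their difference would contradict discreteness.\<close>
  have "\<delta> \<in> C"
  proof -
    obtain c where c: "c \<in> P" "c < \<delta> + e"
      using cInf_lessD[OF ne, of "\<delta> + e"] \<open>e > 0\<close> by (auto simp: \<delta>_def)
    show ?thesis
    proof (cases "c = \<delta>")
      case False
      then have "\<delta> < c" using low[OF c(1)] by simp
      then obtain c' where c': "c' \<in> P" "c' < c"
        using cInf_lessD[OF ne, of c] by (auto simp: \<delta>_def)
      then have "c - c' \<in> C" using c diff by (auto simp: P_def)
      moreover have "\<bar>c - c'\<bar> < e" using low[OF c'(1)] c c' by simp
      ultimately show ?thesis using disc c' by force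
    qed (use c in \<open>auto simp: P_def\<close>)
  qed
  have "c / \<delta> \<in> \<int>" if "c \<in> C" for c
  proof -
    define r where "r = c - of_int \<lfloor>c / \<delta>\<rfloor> * \<delta>"
    have "r \<in> C" unfolding r_def by (intro diff that int_mult \<open>\<delta> \<in> C\<close>)
    moreover have "r \<ge> 0" "r < \<delta>"
      using floor_divide_lower[OF pos, of c] floor_divide_upper[OF pos, of c]
      by (auto simp: r_def algebra_simps)
    ultimately have "r = 0" using low[of r] by (force simp: P_def)
    then have "c / \<delta> = of_int \<lfloor>c / \<delta>\<rfloor>" using pos by (simp add: r_def field_simps)
    then show ?thesis by (metis Ints_of_int)
  qed
  moreover have "c \<in> C" if "c / \<delta> \<in> \<int>" for c
  proof -
    from that obtain k where "c / \<delta> = of_int k" by (auto elim: Ints_cases)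
    then have "c = of_int k * \<delta>" using pos by (simp add: field_simps)
    then show ?thesis using int_mult[OF \<open>\<delta> \<in> C\<close>] by simp
  qed
  ultimately show ?thesis using pos by blast
qed

text \<open>What the arithmetic keeps of a lattice: \<delta> is the unit in which the symplectic
  form is integral on \<Gamma>', and the finite spanning set B reduces statements about vectors to
  finitely many pairings. Finite covolume acts only through these two.\<close>

locale framed_lattice =
  fixes \<Gamma> :: "'n::finite heis set" and \<delta> :: real and B :: "((real^'n) \<times> (real^'n)) set"
  assumes subgroup: "hsubgroup \<Gamma>"
    and isolated: "\<exists>e>0. ball hone e \<inter> \<Gamma> = {hone}"
    and \<delta>_pos: "\<delta> > 0"
    and center_iff: "\<And>c. hel 0 c \<in> \<Gamma> \<longleftrightarrow> c / \<delta> \<in> \<int>"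
    and B_finite: "finite B" and B_sub: "B \<subseteq> hproj ` \<Gamma>" and B_span: "span B = UNIV"

text \<open>The group commutator of two lifts is central with coordinate \<open>wedge u w\<close>.
  This makes the centre of \<Gamma> nontrivial and the form integral on \<Gamma>'.\<close>

lemma commutator_in_subgroup:
  assumes "hsubgroup \<Gamma>" "hel u s \<in> \<Gamma>" "hel w t \<in> \<Gamma>"
  shows "hel 0 (wedge u w) \<in> \<Gamma>"
proof -
  have "hmul (hmul (hel u s) (hel w t)) (hmul (hinv (hel u s)) (hinv (hel w t))) \<in> \<Gamma>"
    using assms by (auto simp: hsubgroup_def simp del: split_paired_All)
  moreover have "hmul (hmul (hel u s) (hel w t)) (hmul (hinv (hel u s)) (hinv (hel w t))) =
      hel 0 (wedge u w)"
    using wedge_skew[of w u] by (simp add: hel_mult hel_inv)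
  ultimately show ?thesis by simp
qed

lemma hel_0_eq: "hel 0 c = (0, 0, c)"
  by (simp add: hel_def hexp_def)

lemma lattice_imp_framed_lattice:
  fixes \<Gamma> :: "'n::finite heis set"
  assumes "lattice \<Gamma>"
  obtains \<delta> B where "framed_lattice \<Gamma> \<delta> B"
proof -
  have \<Gamma>: "hsubgroup \<Gamma>" using assms by (simp add: lattice_def)
  have span: "span (hproj ` \<Gamma>) = UNIV" by (rule span_hproj_lattice[OF assms])
  have one: "hone \<in> \<Gamma>" using \<Gamma> by (simp add: hsubgroup_def)
  then have iso: "\<exists>e>0. ball hone e \<inter> \<Gamma> = {hone}"
    using assms unfolding lattice_def by blast
  then obtain e where e: "e > 0" "ball hone e \<inter> \<Gamma> = {hone}" by blast
  \<comment> \<open>Otherwise nondegeneracy on a spanning set would give \<Gamma>' = {0}, which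
    cannot span a space of positive dimension.\<close>
  have "\<exists>u\<in>hproj ` \<Gamma>. \<exists>w\<in>hproj ` \<Gamma>. wedge u w \<noteq> 0"
  proof (rule ccontr)
    assume "\<not> ?thesis"
    then have "u = 0" if "u \<in> hproj ` \<Gamma>" for u
      using that by (intro wedge_eq_0_span[OF span]) blast
    then have "hproj ` \<Gamma> \<subseteq> {0}" by blast
    then have "span (hproj ` \<Gamma>) \<subseteq> {0}" by (metis span_mono span_insert_0 span_empty)
    then have "(UNIV :: ((real^'n) \<times> (real^'n)) set) \<subseteq> {0}" using span by simp
    then have "(1 :: real^'n, 0 :: real^'n) = 0" by blast
    then show False by (simp add: zero_prod_def)
  qed
  then obtain g h where gh: "g \<in> \<Gamma>" "h \<in> \<Gamma>" "wedge (hproj g) (hproj h) \<noteq> 0" by blast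
  obtain s t where "g = hel (hproj g) s" "h = hel (hproj h) t"
    by (metis hel_cases hproj_hel)
  then have "hel 0 (wedge (hproj g) (hproj h)) \<in> \<Gamma>"
    using gh commutator_in_subgroup[OF \<Gamma>] by metis
  moreover have "hel 0 (x - y) \<in> \<Gamma>" if "hel 0 x \<in> \<Gamma>" "hel 0 y \<in> \<Gamma>" for x y
  proof -
    have "hmul (hel 0 x) (hinv (hel 0 y)) \<in> \<Gamma>" using \<Gamma> that unfolding hsubgroup_def by blast
    then show ?thesis by (simp add: hel_mult hel_inv)
  qed
  moreover have "x = 0" if "hel 0 x \<in> \<Gamma>" "\<bar>x\<bar> < e" for x
  proof -
    have "(hel 0 x :: 'n heis) \<in> ball hone e"
      using that(2) by (simp add: hel_0_eq hone_def dist_Pair_Pair dist_norm)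
    then have "(hel 0 x :: 'n heis) = hone" using that(1) e(2) by blast
    then show ?thesis by (simp add: hone_hel)
  qed
  ultimately obtain \<delta> where \<delta>: "\<delta> > 0" "\<forall>c. c \<in> {c. hel 0 c \<in> \<Gamma>} \<longleftrightarrow> c / \<delta> \<in> \<int>"
    using discrete_subgroup_real_cyclic[of "{c. hel 0 c \<in> \<Gamma>}" e "wedge (hproj g) (hproj h)"] e(1) gh(3)
    by auto
  obtain B where B: "B \<subseteq> hproj ` \<Gamma>" "independent B" "hproj ` \<Gamma> \<subseteq> span B"
    using maximal_independent_subset by blast
  then have "span B = UNIV" using span span_minimal[OF B(3)] by auto
  then have "framed_lattice \<Gamma> \<delta> B"
    using \<Gamma> iso \<delta> B independent_imp_finite by unfold_locales auto
  then show thesis using that by blast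
qed

section \<open>Arithmetic of the projected lattice\<close>

context framed_lattice
begin

lemma mult_mem: "g \<in> \<Gamma> \<Longrightarrow> h \<in> \<Gamma> \<Longrightarrow> hmul g h \<in> \<Gamma>"
  and inv_mem: "g \<in> \<Gamma> \<Longrightarrow> hinv g \<in> \<Gamma>"
  and one_mem: "hone \<in> \<Gamma>"
  using subgroup unfolding hsubgroup_def by blast+

lemma proj_mem_iff: "u \<in> hproj ` \<Gamma> \<longleftrightarrow> (\<exists>s. hel u s \<in> \<Gamma>)"
proof
  assume "u \<in> hproj ` \<Gamma>"
  then obtain g where g: "g \<in> \<Gamma>" "u = hproj g" by blast
  obtain v s where "g = hel v s" by (rule hel_cases)
  then show "\<exists>s. hel u s \<in> \<Gamma>" using g by auto
qed (metis hproj_hel image_eqI)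

lemma hel_scale_int: "hel u s \<in> \<Gamma> \<Longrightarrow> hel (of_int k *\<^sub>R u) (of_int k * s) \<in> \<Gamma>"
proof -
  assume u: "hel u s \<in> \<Gamma>"
  have nat: "hel (of_nat n *\<^sub>R u) (of_nat n * s) \<in> \<Gamma>" for n
  proof (induction n)
    case (Suc n)
    then show ?case using mult_mem[OF Suc u] by (simp add: hel_mult algebra_simps)
  qed (use one_mem in \<open>simp add: hone_hel\<close>)
  show ?thesis
    using nat inv_mem[OF nat] by (cases k rule: int_cases2) (auto simp: hel_inv)
qed

lemma proj_0: "0 \<in> hproj ` \<Gamma>"
  using one_mem by (metis hone_hel proj_mem_iff)

lemma proj_add: "u \<in> hproj ` \<Gamma> \<Longrightarrow> w \<in> hproj ` \<Gamma> \<Longrightarrow> u + w \<in> hproj ` \<Gamma>"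
  unfolding proj_mem_iff by (metis hel_mult mult_mem)

lemma proj_scale_int: "u \<in> hproj ` \<Gamma> \<Longrightarrow> of_int k *\<^sub>R u \<in> hproj ` \<Gamma>"
  unfolding proj_mem_iff by (metis hel_scale_int)

lemma proj_diff: "u \<in> hproj ` \<Gamma> \<Longrightarrow> w \<in> hproj ` \<Gamma> \<Longrightarrow> u - w \<in> hproj ` \<Gamma>"
  using proj_add[OF _ proj_scale_int[of w "-1"]] by simp

lemma proj_sum: "(\<And>i. i \<in> I \<Longrightarrow> f i \<in> hproj ` \<Gamma>) \<Longrightarrow> (\<Sum>i\<in>I. f i) \<in> hproj ` \<Gamma>"
  by (induction I rule: infinite_finite_induct) (auto intro: proj_0 proj_add simp del: image_iff)

lemma wedge_proj_Ints:
  assumes "u \<in> hproj ` \<Gamma>" "w \<in> hproj ` \<Gamma>"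
  shows "wedge u w / \<delta> \<in> \<int>"
proof -
  obtain s t where "hel u s \<in> \<Gamma>" "hel w t \<in> \<Gamma>"
    using assms proj_mem_iff by metis
  then show ?thesis using commutator_in_subgroup[OF subgroup] center_iff by blast
qed

lemma hel_mem_center_iff:
  assumes "hel u s \<in> \<Gamma>"
  shows "hel u t \<in> \<Gamma> \<longleftrightarrow> (t - s) / \<delta> \<in> \<int>"
proof -
  have "hel u t \<in> \<Gamma> \<longleftrightarrow> hel 0 (t - s) \<in> \<Gamma>"
  proof
    assume "hel u t \<in> \<Gamma>"
    from mult_mem[OF this inv_mem[OF assms]] show "hel 0 (t - s) \<in> \<Gamma>"
      by (simp add: hel_mult hel_inv)
  next
    assume "hel 0 (t - s) \<in> \<Gamma>"
    from mult_mem[OF this assms] show "hel u t \<in> \<Gamma>" by (simp add: hel_mult)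
  qed
  then show ?thesis by (simp add: center_iff)
qed

lemma hcoset_hel_eq_iff:
  "hcoset \<Gamma> (hel v s) = hcoset \<Gamma> (hel w t) \<longleftrightarrow> hel (w - v) (t - s - wedge v w / 2) \<in> \<Gamma>"
proof -
  have "hcoset \<Gamma> g = hcoset \<Gamma> h \<longleftrightarrow> hmul (hinv g) h \<in> \<Gamma>" for g h
    unfolding hcoset_eq_iff[OF subgroup] by (metis hmul_hinv_cancel)
  then show ?thesis by (simp add: hel_mult hel_inv)
qed

lemma hcoset_eq_imp_proj_diff:
  assumes "hcoset \<Gamma> g = hcoset \<Gamma> h"
  shows "hproj h - hproj g \<in> hproj ` \<Gamma>"
proof -
  obtain \<gamma> where "\<gamma> \<in> \<Gamma>" "h = hmul g \<gamma>"
    using assms hcoset_eq_iff[OF subgroup] by blast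
  then show ?thesis by simp
qed

text \<open>The pairings with B, divided by \<delta>, are integers that determine u by
  nondegeneracy, and a bound on the norm bounds each of them. The floors in \<open>f\<close> merely
  turn these integral reals into elements of type \<open>int\<close>.\<close>

lemma finite_bounded_proj: "finite {u \<in> hproj ` \<Gamma>. norm u \<le> R}"
proof -
  let ?U = "{u \<in> hproj ` \<Gamma>. norm u \<le> R}"
  define f where "f u = (\<lambda>b\<in>B. \<lfloor>wedge u b / \<delta>\<rfloor>)" for u
  define K where "K b = \<lceil>R * norm b / \<delta>\<rceil>" for b :: "(real^'n) \<times> (real^'n)"
  have int: "of_int \<lfloor>wedge u b / \<delta>\<rfloor> = wedge u b / \<delta>" if "u \<in> ?U" "b \<in> B" for u b
    using that wedge_proj_Ints[of u b] B_sub by (auto elim!: Ints_cases)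
  have "f ` ?U \<subseteq> (\<Pi>\<^sub>E b\<in>B. {- K b .. K b})"
  proof (intro image_subsetI PiE_I)
    fix u b assume u: "u \<in> ?U" and b: "b \<in> B"
    have "\<bar>wedge u b\<bar> \<le> norm u * norm b" by (rule abs_wedge_le)
    also have "\<dots> \<le> R * norm b" using u by (intro mult_right_mono) auto
    finally have "\<bar>wedge u b / \<delta>\<bar> \<le> R * norm b / \<delta>"
      using \<delta>_pos by (simp add: divide_right_mono)
    then have "\<bar>of_int \<lfloor>wedge u b / \<delta>\<rfloor>\<bar> \<le> R * norm b / \<delta>"
      unfolding int[OF u b] .
    then have "\<bar>\<lfloor>wedge u b / \<delta>\<rfloor>\<bar> \<le> K b"
      unfolding K_def by linarith
    then show "f u b \<in> {- K b .. K b}" using b by (auto simp: f_def)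
  qed (auto simp: f_def)
  then have "finite (f ` ?U)"
    by (rule finite_subset) (intro finite_PiE B_finite, simp)
  moreover have "inj_on f ?U"
  proof (rule inj_onI)
    fix u w assume uw: "u \<in> ?U" "w \<in> ?U" "f u = f w"
    have "wedge (u - w) b = 0" if "b \<in> B" for b
    proof -
      have "\<lfloor>wedge u b / \<delta>\<rfloor> = \<lfloor>wedge w b / \<delta>\<rfloor>"
        using fun_cong[OF uw(3), of b] that by (simp add: f_def)
      then have "wedge u b / \<delta> = wedge w b / \<delta>"
        using int[OF uw(1) that] int[OF uw(2) that] by metis
      then show ?thesis using \<delta>_pos by simp
    qed
    then have "u - w = 0" by (intro wedge_eq_0_span[OF B_span])
    then show "u = w" by simp
  qed
  ultimately show ?thesis by (rule finite_imageD)
qed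

text \<open>Splitting off 2 \<mu> with \<mu> in \<Gamma>' is what halving needs, since then \<mu>
  itself is the shift of the midpoint. Removing the even integer part of each real coefficient over
  B leaves a remainder in \<Gamma>' of bounded norm, so finitely many remainders occur.\<close>

lemma proj_decompose_mod_2:
  obtains U where "finite U" "U \<subseteq> hproj ` \<Gamma>"
    "\<And>u. u \<in> hproj ` \<Gamma> \<Longrightarrow> \<exists>u0\<in>U. \<exists>n :: _ \<Rightarrow> int. u = u0 + 2 *\<^sub>R (\<Sum>b\<in>B. of_int (n b) *\<^sub>R b)"
proof
  let ?R = "\<Sum>b\<in>B. 2 * norm b"
  let ?U = "{u \<in> hproj ` \<Gamma>. norm u \<le> ?R}"
  show "finite ?U" by (rule finite_bounded_proj)
  show "?U \<subseteq> hproj ` \<Gamma>" by blast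
  fix u assume u: "u \<in> hproj ` \<Gamma>"
  have "u \<in> span B" using B_span by simp
  then obtain c where c: "u = (\<Sum>b\<in>B. c b *\<^sub>R b)"
    using span_finite[OF B_finite] by auto
  define n where "n b = \<lfloor>c b / 2\<rfloor>" for b
  define u0 where "u0 = (\<Sum>b\<in>B. (c b - 2 * of_int (n b)) *\<^sub>R b)"
  have eq: "u = u0 + 2 *\<^sub>R (\<Sum>b\<in>B. of_int (n b) *\<^sub>R b)"
    by (simp add: c u0_def scaleR_diff_left sum_subtractf scaleR_sum_right)
  have "(\<Sum>b\<in>B. of_int (n b) *\<^sub>R b) \<in> hproj ` \<Gamma>"
    using B_sub by (intro proj_sum proj_scale_int) auto
  from proj_diff[OF u proj_scale_int[OF this, of 2]] have "u0 \<in> hproj ` \<Gamma>"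
    using eq by simp
  moreover have "norm u0 \<le> ?R"
    unfolding u0_def
  proof (rule order_trans[OF norm_sum], rule sum_mono)
    fix b assume "b \<in> B"
    have "\<bar>c b - 2 * of_int (n b)\<bar> \<le> 2" unfolding n_def by linarith
    then show "norm ((c b - 2 * of_int (n b)) *\<^sub>R b) \<le> 2 * norm b"
      by (simp add: mult_right_mono)
  qed
  ultimately show "\<exists>u0\<in>?U. \<exists>n :: _ \<Rightarrow> int. u = u0 + 2 *\<^sub>R (\<Sum>b\<in>B. of_int (n b) *\<^sub>R b)"
    using eq by blast
qed

lemma proj_small_eq_0: obtains e where "e > 0" "\<And>u. u \<in> hproj ` \<Gamma> \<Longrightarrow> norm u < e \<Longrightarrow> u = 0"
proof -
  let ?F = "{u \<in> hproj ` \<Gamma>. norm u \<le> 1}"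
  obtain d where d: "d > 0" "\<forall>u\<in>?F. u \<noteq> 0 \<longrightarrow> d \<le> dist 0 u"
    using finite_set_avoid[OF finite_bounded_proj[of 1], of 0] by blast
  show thesis
    by (rule that[of "min d 1"]) (use d in force)+
qed

end

section \<open>Blockable pairs\<close>

text \<open>Y is the adjoint action of \<open>hinv a\<close> on X. Hence left translations carry
  connecting curves to connecting curves, and the first point of a pair can be moved to the base
  point.\<close>

lemma hexp_conj:
  "\<exists>Y. (X \<noteq> 0 \<longleftrightarrow> Y \<noteq> 0) \<and> (\<forall>t. hmul (hexp (t *\<^sub>R X)) a = hmul a (hexp (t *\<^sub>R Y)))"
proof -
  obtain x y z where X: "X = (x, y, z)" by (metis prod.exhaust)
  obtain u r where a: "a = hel u r" by (rule hel_cases)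
  let ?Y = "(x, y, z + wedge (x, y) u)"
  have "hexp (t *\<^sub>R X) = hel (t *\<^sub>R (x, y)) (t * z)" for t
    using hexp_scale[of t "(x, y)" z] by (simp add: X)
  moreover have "hexp (t *\<^sub>R ?Y) = hel (t *\<^sub>R (x, y)) (t * (z + wedge (x, y) u))" for t
    using hexp_scale[of t "(x, y)"] by simp
  ultimately have "hmul (hexp (t *\<^sub>R X)) a = hmul a (hexp (t *\<^sub>R ?Y))" for t
    using wedge_skew[of u "(x, y)"] by (simp add: a hel_mult algebra_simps del: scaleR_Pair)
  moreover have "X \<noteq> 0 \<longleftrightarrow> ?Y \<noteq> 0"
    unfolding X by (auto simp: zero_prod_def wedge_def)
  ultimately show ?thesis by blast
qed

lemma blockable_act:
  assumes "blockable \<Gamma> m1 m2"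
  shows "blockable \<Gamma> (act a m1) (act a m2)"
proof -
  obtain B where B: "finite B" "B \<subseteq> Mset \<Gamma> - {m1, m2}"
    "\<And>X. connecting m1 m2 X \<Longrightarrow> \<exists>t\<in>{0..1}. act (hexp (t *\<^sub>R X)) m1 \<in> B"
    using assms by (auto simp: blockable_def blocking_set_def simp del: split_paired_All split_paired_Ex)
  have "\<exists>t\<in>{0..1}. act (hexp (t *\<^sub>R X)) (act a m1) \<in> act a ` B"
    if X: "connecting (act a m1) (act a m2) X" for X
  proof -
    obtain Y where Y: "X \<noteq> 0 \<longleftrightarrow> Y \<noteq> 0" "\<And>t. hmul (hexp (t *\<^sub>R X)) a = hmul a (hexp (t *\<^sub>R Y))"
      using hexp_conj[of X a] by blast
    have eq: "act (hexp (t *\<^sub>R X)) (act a m1) = act a (act (hexp (t *\<^sub>R Y)) m1)" for t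
      using Y(2)[of t] by simp
    have "act (hexp Y) m1 = m2"
      using X eq[of 1] by (simp add: connecting_def del: act_act)
    then have "connecting m1 m2 Y"
      using X Y(1) by (simp add: connecting_def)
    then show ?thesis using B(3) eq by (metis image_eqI)
  qed
  moreover have "act a ` B \<subseteq> Mset \<Gamma> - {act a m1, act a m2}"
    using B(2) by auto
  ultimately have "blocking_set \<Gamma> (act a m1) (act a m2) (act a ` B)"
    using B(1) by (simp add: blocking_set_def del: split_paired_All split_paired_Ex)
  then show ?thesis by (auto simp: blockable_def)
qed

lemma midpoint_blockable_act:
  assumes "midpoint_blockable m1 m2"
  shows "midpoint_blockable (act a m1) (act a m2)"
proof -
  have "{act (hexp ((1/2) *\<^sub>R X)) (act a m1) | X. connecting (act a m1) (act a m2) X}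
      \<subseteq> act a ` {act (hexp ((1/2) *\<^sub>R X)) m1 | X. connecting m1 m2 X}"
  proof safe
    fix X assume X: "connecting (act a m1) (act a m2) X"
    obtain Y where Y: "X \<noteq> 0 \<longleftrightarrow> Y \<noteq> 0" "\<And>t. hmul (hexp (t *\<^sub>R X)) a = hmul a (hexp (t *\<^sub>R Y))"
      using hexp_conj[of X a] by blast
    have eq: "act (hexp (t *\<^sub>R X)) (act a m1) = act a (act (hexp (t *\<^sub>R Y)) m1)" for t
      using Y(2)[of t] by simp
    have "act (hexp Y) m1 = m2"
      using X eq[of 1] by (simp add: connecting_def del: act_act)
    then have "connecting m1 m2 Y"
      using X Y(1) by (simp add: connecting_def)
    then show "act (hexp ((1/2) *\<^sub>R X)) (act a m1)
        \<in> act a ` {act (hexp ((1/2) *\<^sub>R X)) m1 | X. connecting m1 m2 X}"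
      using eq[of "1/2"] by blast
  qed
  then show ?thesis
    using assms finite_subset unfolding midpoint_blockable_def by blast
qed

lemma blockable_hcoset_iff:
  "blockable \<Gamma> (hcoset \<Gamma> g) (hcoset \<Gamma> h) \<longleftrightarrow>
    blockable \<Gamma> (hcoset \<Gamma> hone) (hcoset \<Gamma> (hmul (hinv g) h))"
  using blockable_act[of \<Gamma> "hcoset \<Gamma> g" "hcoset \<Gamma> h" "hinv g"]
    blockable_act[of \<Gamma> "hcoset \<Gamma> hone" "hcoset \<Gamma> (hmul (hinv g) h)" g] by auto

lemma midpoint_blockable_hcoset_iff:
  "midpoint_blockable (hcoset \<Gamma> g) (hcoset \<Gamma> h) \<longleftrightarrow>
    midpoint_blockable (hcoset \<Gamma> hone) (hcoset \<Gamma> (hmul (hinv g) h))"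
  using midpoint_blockable_act[of "hcoset \<Gamma> g" "hcoset \<Gamma> h" "hinv g"]
    midpoint_blockable_act[of "hcoset \<Gamma> hone" "hcoset \<Gamma> (hmul (hinv g) h)" g] by auto

lemma act_hexp_hone:
  "act (hexp (t *\<^sub>R (fst v, snd v, s))) (hcoset \<Gamma> hone) = hcoset \<Gamma> (hel (t *\<^sub>R v) (t * s))"
  unfolding hexp_scale by simp

lemma connecting_hone_iff:
  "connecting (hcoset \<Gamma> hone) m (fst v, snd v, s) \<longleftrightarrow>
    (v, s) \<noteq> (0, 0) \<and> hcoset \<Gamma> (hel v s) = m"
  using act_hexp_hone[of 1 v s \<Gamma>] by (auto simp: connecting_def zero_prod_def prod_eq_iff)

text \<open>Puts a quantified Lie algebra vector into the shape on which
  \<open>act_hexp_hone\<close> rewrites.\<close>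

lemma heis_all_iff: "(\<forall>X. P X) \<longleftrightarrow> (\<forall>v s. P (fst v, snd v, s))"
  and heis_ex_iff: "(\<exists>X. P X) \<longleftrightarrow> (\<exists>v s. P (fst v, snd v, s))"
  by auto

lemma blocking_set_hone_iff:
  "blocking_set \<Gamma> (hcoset \<Gamma> hone) m S \<longleftrightarrow> finite S \<and> S \<subseteq> Mset \<Gamma> - {hcoset \<Gamma> hone, m} \<and>
    (\<forall>v s. (v, s) \<noteq> (0, 0) \<longrightarrow> hcoset \<Gamma> (hel v s) = m \<longrightarrow>
      (\<exists>t\<in>{0..1}. hcoset \<Gamma> (hel (t *\<^sub>R v) (t * s)) \<in> S))"
  unfolding blocking_set_def heis_all_iff connecting_hone_iff act_hexp_hone by blast

lemma midpoint_blockable_hone_iff: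
  "midpoint_blockable (hcoset \<Gamma> hone) m \<longleftrightarrow> finite {hcoset \<Gamma> (hel ((1/2) *\<^sub>R v) (1/2 * s)) | v s.
    (v, s) \<noteq> (0, 0) \<and> hcoset \<Gamma> (hel v s) = m}"
  unfolding midpoint_blockable_def heis_ex_iff connecting_hone_iff act_hexp_hone ..

section \<open>Necessity: blockable pairs have rational difference\<close>

context framed_lattice
begin

text \<open>The rational span of \<Gamma>', described by duality: a blocking set yields rational
  pairings directly, and countability can be read off from the pairings with B.\<close>

definition rat_vecs :: "((real^'n) \<times> (real^'n)) set" where
  "rat_vecs = {v. \<forall>u\<in>hproj ` \<Gamma>. wedge v u / \<delta> \<in> \<rat>}"

text \<open>Along the curves from the base point to \<open>g\<gamma>\<^sup>k\<close> a finite blocking set forces two different \<open>k\<close>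
  to be blocked at the same time and the same point; comparing the two centre coordinates then
  yields rationality.\<close>

lemma blockable_imp_rat_vecs:
  assumes "blockable \<Gamma> (hcoset \<Gamma> hone) (hcoset \<Gamma> (hel v s))"
  shows "v \<in> rat_vecs"
proof (rule ccontr)
  assume "v \<notin> rat_vecs"
  then obtain u where u: "u \<in> hproj ` \<Gamma>" and irr: "wedge v u / \<delta> \<notin> \<rat>"
    unfolding rat_vecs_def by blast
  obtain r where r: "hel u r \<in> \<Gamma>" using u proj_mem_iff by blast
  define \<alpha> where "\<alpha> = wedge v u / \<delta>"
  have \<alpha>: "\<alpha> \<notin> \<rat>" "\<alpha> \<noteq> 0" using irr by (auto simp: \<alpha>_def)
  have \<alpha>\<delta>: "wedge v u = \<alpha> * \<delta>" using \<delta>_pos by (simp add: \<alpha>_def)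
  obtain S where S: "finite S" "S \<subseteq> Mset \<Gamma> - {hcoset \<Gamma> hone, hcoset \<Gamma> (hel v s)}"
    and block: "\<And>w q. (w, q) \<noteq> (0, 0) \<Longrightarrow> hcoset \<Gamma> (hel w q) = hcoset \<Gamma> (hel v s) \<Longrightarrow>
      \<exists>t\<in>{0..1}. hcoset \<Gamma> (hel (t *\<^sub>R w) (t * q)) \<in> S"
    using assms unfolding blockable_def blocking_set_hone_iff by blast
  \<comment> \<open>\<open>(w k, q k)\<close> are the logarithmic coordinates of
    \<open>hel v s\<close> times the k-th power of \<open>hel u r\<close>. The pairing of
    \<open>w k\<close> with u does not depend on k.\<close>
  define w where "w k = v + of_int k *\<^sub>R u" for k
  define q where "q k = s + of_int k * r + of_int k * wedge v u / 2" for k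
  have wq: "hcoset \<Gamma> (hel (w k) (q k)) = hcoset \<Gamma> (hel v s)" for k
  proof -
    have "hel (w k) (q k) = hmul (hel v s) (hel (of_int k *\<^sub>R u) (of_int k * r))"
      by (simp add: w_def q_def hel_mult)
    then show ?thesis
      using hcoset_eq_iff[OF subgroup] hel_scale_int[OF r] by metis
  qed
  have "w k \<noteq> 0" for k
  proof
    assume "w k = 0"
    then have "wedge (w k) u = 0" by simp
    then show False using \<alpha> \<delta>_pos by (simp add: w_def \<alpha>\<delta>)
  qed
  then have "\<exists>t\<in>{0..1}. hcoset \<Gamma> (hel (t *\<^sub>R w k) (t * q k)) \<in> S" for k
    using block wq by simp
  then obtain t where t: "\<And>k. 0 \<le> t k \<and> t k \<le> 1"
    "\<And>k. hcoset \<Gamma> (hel (t k *\<^sub>R w k) (t k * q k)) \<in> S"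
    by (metis atLeastAtMost_iff)
  have t0: "t k \<noteq> 0" for k
    using t(2)[of k] S(2) by (auto simp: hone_hel)
  have t1: "t k \<noteq> 1" for k
    using t(2)[of k] S(2) wq[of k] by auto
  \<comment> \<open>The times at which a curve can pass through m: there
    \<open>wedge _ u / \<delta>\<close> equals x \<alpha> and is determined by m modulo integers.
    Allowing any representative g avoids a choice; since \<alpha> is nonzero, [0,1] contains
    finitely many such x.\<close>
  define T where "T m = {x. 0 \<le> x \<and> x \<le> 1 \<and> (\<exists>g. m = hcoset \<Gamma> g \<and> (x * \<alpha> - wedge (hproj g) u / \<delta>) \<in> \<int>)}" for m
  have T: "t k \<in> T (hcoset \<Gamma> (hel (t k *\<^sub>R w k) (t k * q k)))" for k
  proof -
    let ?g = "hel (t k *\<^sub>R w k) (t k * q k)"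
    have "t k * \<alpha> - wedge (hproj ?g) u / \<delta> \<in> \<int>"
      by (simp add: w_def \<alpha>_def)
    then show ?thesis
      unfolding T_def using t(1)[of k] by (intro CollectI conjI exI[of _ ?g]) auto
  qed
  have "finite (T m)" if "m \<in> S" for m
  proof -
    have "m \<in> Mset \<Gamma>" using \<open>m \<in> S\<close> S(2) by blast
    then obtain g where g: "m = hcoset \<Gamma> g" by (rule Mset_cases)
    define \<beta> where "\<beta> = wedge (hproj g) u / \<delta>"
    have "T m \<subseteq> (\<lambda>j. (\<beta> + of_int j) / \<alpha>) ` {- \<lceil>\<bar>\<alpha>\<bar> + \<bar>\<beta>\<bar>\<rceil> .. \<lceil>\<bar>\<alpha>\<bar> + \<bar>\<beta>\<bar>\<rceil>}"
    proof
      fix x assume "x \<in> T m"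
      then obtain g' where x: "0 \<le> x" "x \<le> 1" and g': "m = hcoset \<Gamma> g'"
        "x * \<alpha> - wedge (hproj g') u / \<delta> \<in> \<int>"
        unfolding T_def by blast
      have "wedge (hproj g' - hproj g) u / \<delta> \<in> \<int>"
        using hcoset_eq_imp_proj_diff[of g g'] g g' u by (intro wedge_proj_Ints) auto
      from Ints_add[OF g'(2) this] have "x * \<alpha> - \<beta> \<in> \<int>"
        by (simp add: \<beta>_def diff_divide_distrib)
      then obtain j where j: "x * \<alpha> - \<beta> = of_int j" by (auto elim: Ints_cases)
      have "\<bar>x * \<alpha>\<bar> \<le> \<bar>\<alpha>\<bar>" using x by (simp add: abs_mult mult_left_le_one_le)
      then have "\<bar>of_int j\<bar> \<le> \<bar>\<alpha>\<bar> + \<bar>\<beta>\<bar>" using j by linarith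
      then have "j \<in> {- \<lceil>\<bar>\<alpha>\<bar> + \<bar>\<beta>\<bar>\<rceil> .. \<lceil>\<bar>\<alpha>\<bar> + \<bar>\<beta>\<bar>\<rceil>}" by (simp; linarith)
      moreover have "x = (\<beta> + of_int j) / \<alpha>" using j \<alpha> by (simp add: field_simps)
      ultimately show "x \<in> (\<lambda>j. (\<beta> + of_int j) / \<alpha>) ` {- \<lceil>\<bar>\<alpha>\<bar> + \<bar>\<beta>\<bar>\<rceil> .. \<lceil>\<bar>\<alpha>\<bar> + \<bar>\<beta>\<bar>\<rceil>}"
        by (rule image_eqI[rotated])
    qed
    then show ?thesis by (rule finite_subset) simp
  qed
  then have fin: "finite (Sigma S T)" using S(1) by (intro finite_SigmaI)
  define F where "F k = (hcoset \<Gamma> (hel (t k *\<^sub>R w k) (t k * q k)), t k)" for k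
  have "range F \<subseteq> Sigma S T" using t(2) T by (auto simp: F_def)
  then have "finite (range F)" using fin by (rule finite_subset)
  then have "\<not> inj F" using finite_imageD infinite_UNIV_int by blast
  then obtain k l where kl: "F k = F l" "k \<noteq> l" by (auto simp: inj_def)
  define x where "x = t k"
  have x: "x = t l" "x \<noteq> 0" "x \<noteq> 1"
    using arg_cong[OF kl(1), of snd] t0[of k] t1[of k] by (auto simp: F_def x_def)
  \<comment> \<open>\<tau> u is the difference of the projections of the k-th and l-th curves at the
    common time x, so it lies in \<Gamma>'.\<close>
  define \<tau> where "\<tau> = x * of_int (l - k)"
  have "\<tau> \<noteq> 0" using x kl by (simp add: \<tau>_def)
  have "hcoset \<Gamma> (hel (x *\<^sub>R w k) (x * q k)) = hcoset \<Gamma> (hel (x *\<^sub>R w l) (x * q l))"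
    using arg_cong[OF kl(1), of fst] unfolding F_def x(1)[symmetric] x_def[symmetric] by simp
  then have "hel (x *\<^sub>R w l - x *\<^sub>R w k) (x * q l - x * q k - wedge (x *\<^sub>R w k) (x *\<^sub>R w l) / 2) \<in> \<Gamma>"
    unfolding hcoset_hel_eq_iff .
  moreover have "x *\<^sub>R w l - x *\<^sub>R w k = \<tau> *\<^sub>R u"
    by (simp add: w_def \<tau>_def algebra_simps)
  moreover have "x * q l - x * q k - wedge (x *\<^sub>R w k) (x *\<^sub>R w l) / 2 = \<tau> * (r + (1 - x) / 2 * wedge v u)"
    using wedge_skew[of u v] by (simp add: w_def q_def \<tau>_def field_simps)
  ultimately have mem: "hel (\<tau> *\<^sub>R u) (\<tau> * (r + (1 - x) / 2 * wedge v u)) \<in> \<Gamma>"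
    by simp
  \<comment> \<open>Both u and \<tau> u lie in \<Gamma>', so pairing them with a b that does not
    annihilate u shows that \<tau>, and hence x, is rational.\<close>
  have "\<exists>b\<in>B. wedge u b \<noteq> 0"
  proof (rule ccontr)
    assume "\<not> ?thesis"
    then have "u = 0" by (intro wedge_eq_0_span[OF B_span]) blast
    then show False using \<alpha> by (simp add: \<alpha>_def)
  qed
  then obtain b where b: "b \<in> B" "wedge u b \<noteq> 0" by blast
  have "wedge (\<tau> *\<^sub>R u) b / \<delta> \<in> \<int>" "wedge u b / \<delta> \<in> \<int>"
    using b B_sub u mem proj_mem_iff by (blast intro: wedge_proj_Ints)+
  then have "(wedge (\<tau> *\<^sub>R u) b / \<delta>) / (wedge u b / \<delta>) \<in> \<rat>"
    using Ints_subset_Rats by (blast intro: Rats_divide)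
  then have "\<tau> \<in> \<rat>" using b \<delta>_pos by simp
  moreover have "x = \<tau> / of_int (l - k)" using kl by (simp add: \<tau>_def)
  ultimately have "x \<in> \<rat>" by simp
  obtain i j :: int where ij: "\<tau> = of_int i / of_int j" "j \<noteq> 0"
    using \<open>\<tau> \<in> \<rat>\<close> by (auto elim!: Rats_cases')
  have i: "of_int j * \<tau> = of_int i" "i \<noteq> 0" using ij \<open>\<tau> \<noteq> 0\<close> by auto
  \<comment> \<open>Clearing the denominator of \<tau> gives a second lattice element over i u. Its
    central difference from the i-th power of \<open>hel u r\<close> is i (1 - x) / 2 times
    \<open>wedge v u\<close>. The factor is rational, and it is nonzero because x is neither 0 (so i
    is not 0) nor 1; both are excluded because blocking points avoid the endpoints.\<close>
  have "hel (of_int i *\<^sub>R u) (of_int i * (r + (1 - x) / 2 * wedge v u)) \<in> \<Gamma>"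
    using hel_scale_int[OF mem, of j] i by (simp flip: mult.assoc)
  moreover have "hel (of_int i *\<^sub>R u) (of_int i * r) \<in> \<Gamma>"
    by (rule hel_scale_int[OF r])
  ultimately have "(of_int i * (r + (1 - x) / 2 * wedge v u) - of_int i * r) / \<delta> \<in> \<int>"
    using hel_mem_center_iff by blast
  moreover have "(of_int i * (r + (1 - x) / 2 * wedge v u) - of_int i * r) / \<delta> = of_int i * ((1 - x) / 2) * \<alpha>"
    using \<delta>_pos by (simp add: \<alpha>\<delta> field_simps)
  ultimately have "of_int i * ((1 - x) / 2) * \<alpha> \<in> \<rat>"
    using Ints_subset_Rats by (metis subsetD)
  moreover have "of_int i * ((1 - x) / 2) \<in> \<rat>" "of_int i * ((1 - x) / 2) \<noteq> 0"
    using \<open>x \<in> \<rat>\<close> i x by auto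
  ultimately have "(of_int i * ((1 - x) / 2) * \<alpha>) / (of_int i * ((1 - x) / 2)) \<in> \<rat>"
    by (blast intro: Rats_divide)
  then show False using \<alpha> i x by simp
qed

end

section \<open>Sufficiency: rational differences give finitely many midpoints, and finitely many
  midpoints give a blocking set\<close>

lemma common_denominator:
  assumes "finite A" "\<And>a. a \<in> A \<Longrightarrow> f a \<in> (\<rat> :: real set)"
  shows "\<exists>N::int. N > 0 \<and> (\<forall>a\<in>A. of_int N * f a \<in> \<int>)"
  using assms
proof (induction A)
  case empty
  show ?case by (intro exI[of _ 1]) auto
next
  case (insert a A)
  then obtain N :: int where N: "N > 0" "\<forall>a\<in>A. of_int N * f a \<in> \<int>" by auto
  have "f a \<in> \<rat>" using insert by simp
  then obtain p q :: int where pq: "q > 0" "f a = of_int p / of_int q"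
    by (auto elim!: Rats_cases')
  have "of_int (N * q) * f a = of_int (N * p)"
    using pq by simp
  moreover have "of_int (N * q) * f x \<in> \<int>" if "x \<in> A" for x
  proof -
    have "of_int (N * q) * f x = of_int q * (of_int N * f x)" by simp
    then show ?thesis using N that by (metis Ints_mult Ints_of_int)
  qed
  ultimately have "\<forall>x\<in>insert a A. of_int (N * q) * f x \<in> \<int>"
    by (metis Ints_of_int insertE)
  then show ?case using N pq by (intro exI[of _ "N * q"]) simp
qed

context framed_lattice
begin

lemma hcoset_hel_eq_hone_iff: "hcoset \<Gamma> (hel v s) = hcoset \<Gamma> hone \<longleftrightarrow> hel v s \<in> \<Gamma>"
proof -
  have "hcoset \<Gamma> hone = hcoset \<Gamma> (hel v s) \<longleftrightarrow> hel v s \<in> \<Gamma>"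
    unfolding hone_hel hcoset_hel_eq_iff by simp
  then show ?thesis by metis
qed

text \<open>Right translation by a lattice element over \<open>\<mu>\<close> moves the midpoint over \<open>(v + u) / 2 + \<mu>\<close> to one over
  \<open>(v + u) / 2\<close>, and changes its centre coordinate by a multiple of \<open>\<delta> / 4N\<close>.\<close>

lemma rat_vecs_imp_midpoint_blockable:
  assumes v: "v \<in> rat_vecs"
  shows "midpoint_blockable (hcoset \<Gamma> hone) (hcoset \<Gamma> (hel v s))"
proof -
  obtain U where U: "finite U" "U \<subseteq> hproj ` \<Gamma>"
    "\<And>u. u \<in> hproj ` \<Gamma> \<Longrightarrow> \<exists>u0\<in>U. \<exists>n :: _ \<Rightarrow> int. u = u0 + 2 *\<^sub>R (\<Sum>b\<in>B. of_int (n b) *\<^sub>R b)"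
    using proj_decompose_mod_2 by blast
  have "wedge v b / \<delta> \<in> \<rat>" if "b \<in> B" for b
    using v B_sub that unfolding rat_vecs_def by blast
  then obtain N :: int where N: "N > 0" "\<forall>b\<in>B. of_int N * (wedge v b / \<delta>) \<in> \<int>"
    using common_denominator[OF B_finite, of "\<lambda>b. wedge v b / \<delta>"] by blast
  have "\<exists>r. hel u r \<in> \<Gamma>" if "u \<in> U" for u using U(2) that proj_mem_iff by blast
  then obtain r where r: "\<And>u. u \<in> U \<Longrightarrow> hel u (r u) \<in> \<Gamma>" by metis
  \<comment> \<open>The model midpoints: half the logarithmic coordinates of \<open>hel v s\<close>
    times \<open>hel u (r u)\<close>, moved centrally by l steps of size \<delta> / 4N. Since 4N
    steps make up the central lattice element \<delta>, the range 0 to 4N - 1 suffices.\<close>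
  define P where "P = (\<lambda>(u, l::int). hcoset \<Gamma> (hel ((1/2) *\<^sub>R (v + u))
    (s / 2 + r u / 2 + wedge v u / 4 + \<delta> * of_int l / (4 * of_int N))))"
  have "hcoset \<Gamma> (hel ((1/2) *\<^sub>R w) (1/2 * q)) \<in> P ` (U \<times> {0..<4 * N})"
    if wq: "hcoset \<Gamma> (hel w q) = hcoset \<Gamma> (hel v s)" for w q
  proof -
    have mem: "hel (w - v) (q - s - wedge v w / 2) \<in> \<Gamma>"
      using wq[symmetric] unfolding hcoset_hel_eq_iff .
    then have "w - v \<in> hproj ` \<Gamma>" using proj_mem_iff by blast
    then obtain u n where u: "u \<in> U" and n: "w - v = u + 2 *\<^sub>R (\<Sum>b\<in>B. of_int (n b :: int) *\<^sub>R b)"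
      using U(3) by blast
    define \<mu> where "\<mu> = (\<Sum>b\<in>B. of_int (n b :: int) *\<^sub>R b)"
    have w: "w = v + u + 2 *\<^sub>R \<mu>" using n by (simp add: \<mu>_def algebra_simps)
    have \<mu>: "\<mu> \<in> hproj ` \<Gamma>"
      unfolding \<mu>_def using B_sub by (intro proj_sum proj_scale_int) auto
    then obtain \<tau> where \<tau>: "hel \<mu> \<tau> \<in> \<Gamma>" using proj_mem_iff by blast
    have "hmul (hel u (r u)) (hel (of_int 2 *\<^sub>R \<mu>) (of_int 2 * \<tau>)) \<in> \<Gamma>"
      by (intro mult_mem r u hel_scale_int \<tau>)
    then have "hel (w - v) (r u + 2 * \<tau> + wedge u \<mu>) \<in> \<Gamma>"
      by (simp add: hel_mult w)
    from mem[unfolded hel_mem_center_iff[OF this]] obtain k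
      where k: "(q - s - wedge v w / 2 - (r u + 2 * \<tau> + wedge u \<mu>)) / \<delta> = of_int k"
      by (auto elim: Ints_cases)
    have "wedge u \<mu> / \<delta> \<in> \<int>" using U(2) u \<mu> by (intro wedge_proj_Ints) auto
    then obtain j where j: "wedge u \<mu> / \<delta> = of_int j" by (auto elim: Ints_cases)
    have "of_int N * (wedge v \<mu> / \<delta>) = (\<Sum>b\<in>B. of_int (n b) * (of_int N * (wedge v b / \<delta>)))"
      by (simp add: \<mu>_def wedge_sum_right sum_distrib_left sum_divide_distrib mult_ac)
    also have "\<dots> \<in> \<int>"
    proof (rule Ints_sum)
      fix b assume "b \<in> B"
      then show "of_int (n b) * (of_int N * (wedge v b / \<delta>)) \<in> \<int>"
        using N(2) Ints_mult[OF Ints_of_int] by blast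
    qed
    finally obtain i where i: "of_int N * (wedge v \<mu> / \<delta>) = of_int i" by (auto elim: Ints_cases)
    \<comment> \<open>Collects the central error in steps of \<delta> / 4N:
      \<open>wedge u \<mu> / 4\<close> is j N steps, \<open>wedge v \<mu> / 4\<close> is i steps,
      and half of the central offset k \<delta> of the endpoint is 2 k N steps.\<close>
    define l where "l = j * N + i + 2 * k * N"
    have Npos: "real_of_int N > 0" using N(1) by simp
    have q: "q = s + wedge v u / 2 + wedge v \<mu> + r u + 2 * \<tau> + wedge u \<mu> + of_int k * \<delta>"
      using k \<delta>_pos by (simp add: w field_simps)
    have wu: "wedge u \<mu> = of_int j * \<delta>" and wv: "wedge v \<mu> = of_int i * \<delta> / of_int N"
      using i j \<delta>_pos Npos by (auto simp: field_simps)
    have div: "of_int (l mod (4 * N)) = real_of_int l - 4 * of_int N * of_int (l div (4 * N))"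
      unfolding minus_mult_div_eq_mod[symmetric, of l "4 * N"] by simp
    let ?C = "s / 2 + r u / 2 + wedge v u / 4 + \<delta> * of_int (l mod (4 * N)) / (4 * of_int N)"
    have inv\<mu>: "hel (- \<mu>) (- \<tau>) \<in> \<Gamma>" using inv_mem[OF \<tau>] by (simp add: hel_inv)
    have "(?C - 1/2 * q - wedge ((1/2) *\<^sub>R w) ((1/2) *\<^sub>R (v + u)) / 2 - - \<tau>) / \<delta>
        = - of_int (l div (4 * N))"
    proof -
      have "wedge ((1/2) *\<^sub>R w) ((1/2) *\<^sub>R (v + u)) = - (wedge v \<mu> + wedge u \<mu>) / 2"
        using wedge_skew[of \<mu> v] wedge_skew[of \<mu> u] wedge_skew[of u v] by (simp add: w field_simps)
      then have "?C - 1/2 * q - wedge ((1/2) *\<^sub>R w) ((1/2) *\<^sub>R (v + u)) / 2 - - \<tau>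
          = \<delta> * of_int (l mod (4 * N)) / (4 * of_int N) - wedge v \<mu> / 4 - wedge u \<mu> / 4 - of_int k * \<delta> / 2"
        unfolding q by (simp add: field_simps)
      also have "\<dots> = \<delta> * (of_int (l mod (4 * N)) - of_int l) / (4 * of_int N)"
        unfolding wu wv l_def using Npos by (simp add: field_simps)
      also have "\<dots> = - of_int (l div (4 * N)) * \<delta>"
        unfolding div using Npos by simp
      finally show ?thesis using \<delta>_pos by (simp only: nonzero_mult_div_cancel_right)
    qed
    then have "(?C - 1/2 * q - wedge ((1/2) *\<^sub>R w) ((1/2) *\<^sub>R (v + u)) / 2 - - \<tau>) / \<delta> \<in> \<int>"
      by (metis Ints_minus Ints_of_int)
    then have "hel (- \<mu>) (?C - 1/2 * q - wedge ((1/2) *\<^sub>R w) ((1/2) *\<^sub>R (v + u)) / 2) \<in> \<Gamma>"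
      unfolding hel_mem_center_iff[OF inv\<mu>] .
    moreover have "(1/2) *\<^sub>R (v + u) - (1/2) *\<^sub>R w = - \<mu>"
      by (simp add: w algebra_simps)
    ultimately have "hcoset \<Gamma> (hel ((1/2) *\<^sub>R w) (1/2 * q)) = P (u, l mod (4 * N))"
      unfolding P_def case_prod_conv hcoset_hel_eq_iff by simp
    then show ?thesis using u N(1) by auto
  qed
  then have "{hcoset \<Gamma> (hel ((1/2) *\<^sub>R w) (1/2 * q)) | w q. (w, q) \<noteq> (0, 0) \<and>
      hcoset \<Gamma> (hel w q) = hcoset \<Gamma> (hel v s)} \<subseteq> P ` (U \<times> {0..<4 * N})"
    by blast
  then show ?thesis
    unfolding midpoint_blockable_hone_iff by (rule finite_subset) (simp add: U(1))
qed

text \<open>The dyadic fractions are nontrivial and tend to the identity, which is isolated in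
  \<Gamma>.\<close>

lemma not_all_dyadic_fractions_mem:
  assumes "(v, s) \<noteq> (0, 0)"
  shows "\<exists>j. hel ((1/2) ^ j *\<^sub>R v) ((1/2) ^ j * s) \<notin> \<Gamma>"
proof (rule ccontr)
  assume *: "\<not> ?thesis"
  obtain e where e: "e > 0" "ball hone e \<inter> \<Gamma> = {hone}" using isolated by blast
  have "(\<lambda>j. (1/2 :: real) ^ j) \<longlonglongrightarrow> 0" by (intro LIMSEQ_realpow_zero) auto
  then have "(\<lambda>j. hel ((1/2) ^ j *\<^sub>R v) ((1/2) ^ j * s)) \<longlonglongrightarrow>
      (0 *\<^sub>R fst v, 0 *\<^sub>R snd v, 0 * s + inner (0 *\<^sub>R fst v) (0 *\<^sub>R snd v) / 2)"
    unfolding hel_def hexp_def fst_scaleR snd_scaleR prod.case by (intro tendsto_intros) auto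
  then have "(\<lambda>j. hel ((1/2) ^ j *\<^sub>R v) ((1/2) ^ j * s)) \<longlonglongrightarrow> hone" by (simp add: hone_def)
  then have "\<forall>\<^sub>F j in sequentially. hel ((1/2) ^ j *\<^sub>R v) ((1/2) ^ j * s) \<in> ball hone e"
    using e(1) by (intro topological_tendstoD) auto
  then obtain j where "hel ((1/2) ^ j *\<^sub>R v) ((1/2) ^ j * s) \<in> ball hone e"
    by (meson eventually_sequentially order_refl)
  then have "hel ((1/2) ^ j *\<^sub>R v) ((1/2) ^ j * s) = hone"
    using * e(2) by blast
  then show False using assms by (simp add: hone_hel)
qed

text \<open>For a closed curve the midpoint may be the base point itself, which a blocking set must avoid; such
  a curve is blocked at the midpoint of its shortest closed dyadic initial piece instead.\<close>

lemma midpoint_blockable_imp_blockable: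
  assumes "midpoint_blockable (hcoset \<Gamma> hone) m"
  shows "blockable \<Gamma> (hcoset \<Gamma> hone) m"
proof -
  define Q where "Q = {hcoset \<Gamma> (hel ((1/2) *\<^sub>R v) (1/2 * s)) | v s. (v, s) \<noteq> (0, 0) \<and> hcoset \<Gamma> (hel v s) = m}"
  have fin: "finite Q" using assms unfolding midpoint_blockable_hone_iff Q_def .
  have dbl: "hel v s \<in> \<Gamma>" if "hel ((1/2) *\<^sub>R v) (1/2 * s) \<in> \<Gamma>" for v s
    using hel_scale_int[OF that, of 2] by simp
  have "\<exists>t\<in>{0..1}. hcoset \<Gamma> (hel (t *\<^sub>R v) (t * s)) \<in> Q - {hcoset \<Gamma> hone, m}"
    if vs: "(v, s) \<noteq> (0, 0)" and m: "hcoset \<Gamma> (hel v s) = m" for v s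
  proof (cases "m = hcoset \<Gamma> hone")
    case False
    \<comment> \<open>The endpoint is the square of the midpoint. Hence the midpoint represents the
      base point or m only if it lies in \<Gamma>, and then m would be the base point.\<close>
    then have not: "hel ((1/2) *\<^sub>R v) (1/2 * s) \<notin> \<Gamma>"
      using dbl m hcoset_hel_eq_hone_iff by metis
    moreover have "hcoset \<Gamma> (hel ((1/2) *\<^sub>R v) (1/2 * s)) = m \<longleftrightarrow> hel ((1/2) *\<^sub>R v) (1/2 * s) \<in> \<Gamma>"
    proof -
      have "v - (1/2) *\<^sub>R v = (1/2) *\<^sub>R v" using scaleR_left_diff_distrib[of 1 "1/2" v] by simp
      then show ?thesis unfolding m[symmetric] hcoset_hel_eq_iff by simp
    qed
    ultimately have "hcoset \<Gamma> (hel ((1/2) *\<^sub>R v) (1/2 * s)) \<in> Q - {hcoset \<Gamma> hone, m}"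
      using vs m hcoset_hel_eq_hone_iff unfolding Q_def by blast
    then show ?thesis by (intro bexI[of _ "1/2"]) auto
  next
    case True
    define D where "D j \<longleftrightarrow> hel ((1/2) ^ j *\<^sub>R v) ((1/2) ^ j * s) \<in> \<Gamma>" for j
    have "D 0" using m True hcoset_hel_eq_hone_iff by (simp add: D_def)
    have "\<exists>j. D j \<and> \<not> D (Suc j)"
    proof (rule ccontr)
      assume "\<not> ?thesis"
      then have "D j" for j using \<open>D 0\<close> by (induction j) auto
      then show False using not_all_dyadic_fractions_mem[OF vs] by (simp add: D_def)
    qed
    then obtain j where j: "D j" "\<not> D (Suc j)" by blast
    let ?v = "(1/2) ^ j *\<^sub>R v" and ?s = "(1/2) ^ j * s"
    have half: "(1/2) ^ Suc j *\<^sub>R v = (1/2) *\<^sub>R ?v" "(1/2) ^ Suc j * s = 1/2 * ?s" by simp_all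
    have "(?v, ?s) \<noteq> (0, 0)" using vs by auto
    moreover have "hcoset \<Gamma> (hel ?v ?s) = m"
      using j(1) True hcoset_hel_eq_hone_iff by (simp add: D_def)
    \<comment> \<open>The closed initial piece, reparametrized to [0,1], is itself a connecting
      curve, so its midpoint already belongs to the finite set Q.\<close>
    ultimately have "hcoset \<Gamma> (hel ((1/2) *\<^sub>R ?v) (1/2 * ?s)) \<in> Q" unfolding Q_def by blast
    moreover have "hcoset \<Gamma> (hel ((1/2) *\<^sub>R ?v) (1/2 * ?s)) \<noteq> hcoset \<Gamma> hone"
      using j(2) hcoset_hel_eq_hone_iff unfolding D_def half by blast
    ultimately have "hcoset \<Gamma> (hel ((1/2) ^ Suc j *\<^sub>R v) ((1/2) ^ Suc j * s)) \<in> Q - {hcoset \<Gamma> hone, m}"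
      unfolding half using True by blast
    moreover have "(1/2 :: real) ^ Suc j \<in> {0..1}" by (simp add: power_le_one del: power_Suc)
    ultimately show ?thesis by blast
  qed
  moreover have "Q \<subseteq> Mset \<Gamma>" unfolding Q_def by auto
  ultimately have "blocking_set \<Gamma> (hcoset \<Gamma> hone) m (Q - {hcoset \<Gamma> hone, m})"
    unfolding blocking_set_hone_iff using fin by blast
  then show ?thesis unfolding blockable_def by blast
qed

text \<open>With the first point moved to the base point, the three conditions close a cycle:
  blockable, rational, midpoint blockable, blockable.\<close>

lemma blockable_iff_rat_vecs:
  "blockable \<Gamma> (hcoset \<Gamma> g) (hcoset \<Gamma> h) \<longleftrightarrow> hproj h - hproj g \<in> rat_vecs"
  and midpoint_blockable_iff_rat_vecs:
  "midpoint_blockable (hcoset \<Gamma> g) (hcoset \<Gamma> h) \<longleftrightarrow> hproj h - hproj g \<in> rat_vecs"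
proof -
  obtain v s where vs: "hmul (hinv g) h = hel v s" by (rule hel_cases)
  have v: "v = hproj h - hproj g"
    using arg_cong[OF vs, of hproj] unfolding hproj_hmul hproj_hinv hproj_hel by simp
  show "blockable \<Gamma> (hcoset \<Gamma> g) (hcoset \<Gamma> h) \<longleftrightarrow> hproj h - hproj g \<in> rat_vecs"
    unfolding blockable_hcoset_iff[of _ g h] vs v[symmetric]
    using blockable_imp_rat_vecs rat_vecs_imp_midpoint_blockable midpoint_blockable_imp_blockable by blast
  show "midpoint_blockable (hcoset \<Gamma> g) (hcoset \<Gamma> h) \<longleftrightarrow> hproj h - hproj g \<in> rat_vecs"
    unfolding midpoint_blockable_hcoset_iff[of _ g h] vs v[symmetric]
    using blockable_imp_rat_vecs rat_vecs_imp_midpoint_blockable midpoint_blockable_imp_blockable by blast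
qed

end

section \<open>Topology and measure of the set of blockable pairs\<close>

lemma openin_Mtop_iff: "openin (Mtop \<Gamma>) A \<longleftrightarrow> A \<subseteq> Mset \<Gamma> \<and> open {g. hcoset \<Gamma> g \<in> A}"
  unfolding Mtop_def topology_inverse'[OF istopology_Mtop] ..

lemma topspace_Mtop [simp]: "topspace (Mtop \<Gamma>) = Mset \<Gamma>"
proof
  show "topspace (Mtop \<Gamma>) \<subseteq> Mset \<Gamma>"
    using openin_topspace[of "Mtop \<Gamma>"] unfolding openin_Mtop_iff by blast
  have "openin (Mtop \<Gamma>) (Mset \<Gamma>)" unfolding openin_Mtop_iff by simp
  then show "Mset \<Gamma> \<subseteq> topspace (Mtop \<Gamma>)" by (rule openin_subset)
qed

text \<open>The coset map is open: the saturation of A is a union of right translates of A.\<close>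

lemma openin_Mtop_image:
  assumes "hsubgroup \<Gamma>" "open A"
  shows "openin (Mtop \<Gamma>) (hcoset \<Gamma> ` A)"
proof -
  have "{g. hcoset \<Gamma> g \<in> hcoset \<Gamma> ` A} = (\<Union>\<gamma>\<in>\<Gamma>. (\<lambda>g. hmul g \<gamma>) -` A)"
    unfolding image_iff hcoset_eq_iff[OF assms(1)] by blast
  moreover have "open ((\<lambda>g. hmul g \<gamma>) -` A)" for \<gamma>
    using assms(2) continuous_on_hmul(1) by (rule open_vimage)
  ultimately show ?thesis unfolding openin_Mtop_iff by auto
qed

text \<open>A product of quotient maps need not be a quotient map in general. Here the coset map is
  open, so boxes around a point outside the preimage descend to boxes in M \<times> M.\<close>

lemma closedin_Mtop_prodI:
  assumes \<Gamma>: "hsubgroup \<Gamma>" and S: "S \<subseteq> Mset \<Gamma> \<times> Mset \<Gamma>"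
    and closed: "closed {(g, h). (hcoset \<Gamma> g, hcoset \<Gamma> h) \<in> S}" (is "closed ?P")
  shows "closedin (prod_topology (Mtop \<Gamma>) (Mtop \<Gamma>)) S"
  unfolding closedin_def openin_prod_topology_alt topspace_prod_topology topspace_Mtop
proof (intro conjI S allI impI)
  fix m1 m2 assume m: "(m1, m2) \<in> Mset \<Gamma> \<times> Mset \<Gamma> - S"
  then obtain g h where gh: "m1 = hcoset \<Gamma> g" "m2 = hcoset \<Gamma> h"
    by (metis DiffD1 Mset_cases mem_Sigma_iff)
  then have "(g, h) \<in> - ?P" using m by simp
  moreover have "open (- ?P)" using closed by (rule open_Compl)
  ultimately obtain A1 A2 where A: "open A1" "open A2" "g \<in> A1" "h \<in> A2" "A1 \<times> A2 \<subseteq> - ?P"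
    by (metis open_prod_def mem_Sigma_iff)
  have "hcoset \<Gamma> ` A1 \<times> hcoset \<Gamma> ` A2 \<subseteq> Mset \<Gamma> \<times> Mset \<Gamma> - S"
    using A(5) by auto
  then show "\<exists>U V. openin (Mtop \<Gamma>) U \<and> openin (Mtop \<Gamma>) V \<and> m1 \<in> U \<and> m2 \<in> V \<and>
      U \<times> V \<subseteq> Mset \<Gamma> \<times> Mset \<Gamma> - S"
    unfolding gh using A(3,4)
    by (intro exI[of _ "hcoset \<Gamma> ` A1"] exI[of _ "hcoset \<Gamma> ` A2"] conjI
        openin_Mtop_image[OF \<Gamma>] A imageI)
qed

lemma smooth_on_const: "smooth_on U (\<lambda>x. c)"
proof -
  have "Ck_on k U (\<lambda>x. c)" for k
    by (induction k arbitrary: c) (auto simp: frechet_derivative_const)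
  then show ?thesis by (simp add: smooth_on_def)
qed

lemma smooth_on_translation: "smooth_on U (\<lambda>x. x + c)"
proof -
  have "((\<lambda>x. x + c) has_derivative (\<lambda>v. v)) (at x)" for x
    by (auto intro!: derivative_eq_intros)
  then have D: "frechet_derivative (\<lambda>x. x + c) (at x) = (\<lambda>v. v)" for x
    by (metis frechet_derivative_at)
  have "Ck_on k U (\<lambda>x. x + c)" for k
    using smooth_on_const[of U]
    by (cases k) (auto simp: D smooth_on_def intro!: continuous_intros derivative_intros)
  then show ?thesis by (simp add: smooth_on_def)
qed

section \<open>The blockable pairs as a dense countable union of closed submanifolds\<close>

definition hdiff :: "'n::finite heis \<times> 'n heis \<Rightarrow> (real^'n) \<times> (real^'n)" where
  "hdiff p = hproj (snd p) - hproj (fst p)"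

lemma linear_hdiff: "linear hdiff"
  by (rule linearI) (auto simp: hdiff_def hproj_def algebra_simps)

lemma continuous_on_hdiff [continuous_intros]: "continuous_on S hdiff"
  by (rule linear_continuous_on[OF linear_hdiff[unfolded linear_conv_bounded_linear]])

lemma hdiff_surj: "\<exists>p. hdiff p = v"
  by (rule exI[of _ "(0, hel v 0)"]) (simp add: hdiff_def, simp add: hproj_def zero_prod_def)

context framed_lattice
begin

lemma rat_vecs_0: "0 \<in> rat_vecs"
  and rat_vecs_add: "u \<in> rat_vecs \<Longrightarrow> w \<in> rat_vecs \<Longrightarrow> u + w \<in> rat_vecs"
  and rat_vecs_scale: "q \<in> \<rat> \<Longrightarrow> u \<in> rat_vecs \<Longrightarrow> q *\<^sub>R u \<in> rat_vecs"
  unfolding rat_vecs_def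
  by (auto simp: add_divide_distrib simp flip: times_divide_eq_right)

lemma proj_rat_vecs: "u \<in> hproj ` \<Gamma> \<Longrightarrow> u \<in> rat_vecs"
  using wedge_proj_Ints Ints_subset_Rats unfolding rat_vecs_def by blast

text \<open>Pairing with B embeds \<open>rat_vecs\<close> into finitely many copies of the
  rationals.\<close>

lemma countable_rat_vecs: "countable rat_vecs"
proof -
  define f where "f v = (\<lambda>b\<in>B. wedge v b / \<delta>)" for v
  have "f ` rat_vecs \<subseteq> (\<Pi>\<^sub>E b\<in>B. \<rat>)"
    using B_sub unfolding rat_vecs_def f_def by auto
  moreover have "countable (\<Pi>\<^sub>E b\<in>B. \<rat> :: real set)"
    by (intro countable_PiE B_finite countable_rat)
  ultimately have "countable (f ` rat_vecs)" by (rule countable_subset)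
  moreover have "inj f"
  proof (rule injI)
    fix u w assume uw: "f u = f w"
    have "wedge (u - w) b = 0" if "b \<in> B" for b
      using fun_cong[OF uw, of b] that \<delta>_pos by (simp add: f_def)
    then have "u - w = 0" by (intro wedge_eq_0_span[OF B_span])
    then show "u = w" by simp
  qed
  then have "inj_on f rat_vecs" by (rule inj_on_subset) simp
  ultimately show ?thesis by (rule countable_image_inj_on)
qed

text \<open>\<open>rat_vecs\<close> is a rational vector space containing the real spanning set B,
  so real coefficients over B can be approximated one at a time by rational ones.\<close>

lemma rat_vecs_dense: "e > 0 \<Longrightarrow> \<exists>w\<in>rat_vecs. dist w v < e"
proof -
  have "v \<in> span B" using B_span by simp
  then have "\<forall>e>0. \<exists>w\<in>rat_vecs. dist w v < e"
  proof (induction rule: span_induct_alt)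
    case base
    show ?case using rat_vecs_0 by force
  next
    case (step c b y)
    show ?case
    proof (intro allI impI)
      fix e :: real assume "e > 0"
      then obtain w where w: "w \<in> rat_vecs" "dist w y < e / 2"
        using step.IH by (meson half_gt_zero)
      \<comment> \<open>The summand 1 keeps K positive, so that the division by 2 K also works for b
        = 0.\<close>
      define K where "K = norm b + 1"
      define d where "d = e / (2 * K)"
      have nb: "K > 0" by (simp add: K_def add_nonneg_pos)
      have "d > 0" using \<open>e > 0\<close> nb by (simp add: d_def)
      then obtain q where q: "q \<in> \<rat>" "c < q" "q < c + d"
        using Rats_dense_in_real[of c "c + d"] by auto
      have "norm (q *\<^sub>R b - c *\<^sub>R b) = (q - c) * norm b"
        using q by (simp flip: scaleR_left_diff_distrib)
      also have "\<dots> \<le> d * K"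
        unfolding K_def using q \<open>d > 0\<close> by (intro mult_mono) auto
      also have "\<dots> = e / 2" using nb by (simp add: d_def)
      finally have "norm (q *\<^sub>R b - c *\<^sub>R b) \<le> e / 2" .
      moreover have "norm (w - y) < e / 2" using w(2) by (simp add: dist_norm)
      moreover have eq: "(q *\<^sub>R b + w) - (c *\<^sub>R b + y) = (q *\<^sub>R b - c *\<^sub>R b) + (w - y)" by simp
      ultimately have "dist (q *\<^sub>R b + w) (c *\<^sub>R b + y) < e"
        unfolding dist_norm eq
        using norm_triangle_ineq[of "q *\<^sub>R b - c *\<^sub>R b" "w - y"] by linarith
      moreover have "q *\<^sub>R b + w \<in> rat_vecs"
        using step.hyps B_sub q w by (intro rat_vecs_add rat_vecs_scale) (auto intro: proj_rat_vecs)
      ultimately show "\<exists>w\<in>rat_vecs. dist w (c *\<^sub>R b + y) < e" by blast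
    qed
  qed
  then show "e > 0 \<Longrightarrow> ?thesis" by blast
qed

lemma mem_blockable_pairs_iff:
  "(hcoset \<Gamma> g, hcoset \<Gamma> h) \<in> blockable_pairs \<Gamma> \<longleftrightarrow> hproj h - hproj g \<in> rat_vecs"
  by (simp add: blockable_pairs_def blockable_iff_rat_vecs)

text \<open>The first point stays fixed: the partners of any given point are already dense in
  M.\<close>

lemma blockable_pairs_dense:
  "prod_topology (Mtop \<Gamma>) (Mtop \<Gamma>) closure_of blockable_pairs \<Gamma> = Mset \<Gamma> \<times> Mset \<Gamma>"
proof
  show "prod_topology (Mtop \<Gamma>) (Mtop \<Gamma>) closure_of blockable_pairs \<Gamma> \<subseteq> Mset \<Gamma> \<times> Mset \<Gamma>"
    using closure_of_subset_topspace[of "prod_topology (Mtop \<Gamma>) (Mtop \<Gamma>)"] by simp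
  show "Mset \<Gamma> \<times> Mset \<Gamma> \<subseteq> prod_topology (Mtop \<Gamma>) (Mtop \<Gamma>) closure_of blockable_pairs \<Gamma>"
  proof (rule subrelI)
    fix m1 m2 assume m: "(m1, m2) \<in> Mset \<Gamma> \<times> Mset \<Gamma>"
    then obtain g h where gh: "m1 = hcoset \<Gamma> g" "m2 = hcoset \<Gamma> h"
      by (metis Mset_cases mem_Sigma_iff)
    have "\<exists>y. y \<in> blockable_pairs \<Gamma> \<and> y \<in> T"
      if T: "(m1, m2) \<in> T" "openin (prod_topology (Mtop \<Gamma>) (Mtop \<Gamma>)) T" for T
    proof -
      obtain U V where UV: "openin (Mtop \<Gamma>) U" "openin (Mtop \<Gamma>) V" "m1 \<in> U" "m2 \<in> V" "U \<times> V \<subseteq> T"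
        using T unfolding openin_prod_topology_alt by meson
      \<comment> \<open>\<open>f u\<close> has projection u and the last matrix coordinate of h.
        Thus f is a continuous section of \<open>hproj\<close> through h, and only the projection of
        h is perturbed.\<close>
      define f where "f u = (fst u, snd u, snd (snd h))" for u :: "(real^'n) \<times> (real^'n)"
      have "continuous_on UNIV f" unfolding f_def by (intro continuous_intros)
      moreover have "open {h. hcoset \<Gamma> h \<in> V}" using UV(2) by (simp add: openin_Mtop_iff)
      ultimately have "open (f -` {h. hcoset \<Gamma> h \<in> V})" by (intro open_vimage)
      moreover have "hproj h \<in> f -` {h. hcoset \<Gamma> h \<in> V}"
        using UV(4) gh by (simp add: f_def hproj_def)
      ultimately obtain e where e: "e > 0" "ball (hproj h) e \<subseteq> f -` {h. hcoset \<Gamma> h \<in> V}"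
        by (meson open_contains_ball)
      obtain w where w: "w \<in> rat_vecs" "dist w (hproj h - hproj g) < e"
        using rat_vecs_dense[OF e(1)] by blast
      have "dist (hproj h) (w + hproj g) < e"
        using w(2) by (simp add: dist_norm norm_minus_commute algebra_simps)
      then have "w + hproj g \<in> ball (hproj h) e" by simp
      then have "hcoset \<Gamma> (f (w + hproj g)) \<in> V" using e(2) by blast
      then have "(m1, hcoset \<Gamma> (f (w + hproj g))) \<in> T" using UV by blast
      moreover have "hproj (f (w + hproj g)) - hproj g = w" by (simp add: f_def hproj_def)
      then have "(m1, hcoset \<Gamma> (f (w + hproj g))) \<in> blockable_pairs \<Gamma>"
        unfolding gh mem_blockable_pairs_iff using w(1) by simp
      ultimately show ?thesis by (intro exI conjI)
    qed
    then show "(m1, m2) \<in> prod_topology (Mtop \<Gamma>) (Mtop \<Gamma>) closure_of blockable_pairs \<Gamma>"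
      unfolding in_closure_of using m by simp
  qed
qed

text \<open>The fibre over the class of w of the map from M \<times> M to the torus of vectors
  modulo \<Gamma>' that takes the difference of projections. It depends on w only modulo
  \<Gamma>'.\<close>

definition layer :: "(real^'n) \<times> (real^'n) \<Rightarrow> ('n heis set \<times> 'n heis set) set" where
  "layer w = {(hcoset \<Gamma> g, hcoset \<Gamma> h) | g h. hproj h - hproj g - w \<in> hproj ` \<Gamma>}"

lemma mem_layer_iff:
  "(hcoset \<Gamma> g, hcoset \<Gamma> h) \<in> layer w \<longleftrightarrow> hproj h - hproj g - w \<in> hproj ` \<Gamma>"
proof
  assume "(hcoset \<Gamma> g, hcoset \<Gamma> h) \<in> layer w"
  then obtain g' h' where gh: "hcoset \<Gamma> g = hcoset \<Gamma> g'" "hcoset \<Gamma> h = hcoset \<Gamma> h'"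
    and d: "hproj h' - hproj g' - w \<in> hproj ` \<Gamma>"
    unfolding layer_def by blast
  have "(hproj h' - hproj g' - w) - (hproj h' - hproj h) + (hproj g' - hproj g) \<in> hproj ` \<Gamma>"
    by (intro proj_add proj_diff d hcoset_eq_imp_proj_diff gh)
  moreover have "(hproj h' - hproj g' - w) - (hproj h' - hproj h) + (hproj g' - hproj g) = hproj h - hproj g - w"
    by simp
  ultimately show "hproj h - hproj g - w \<in> hproj ` \<Gamma>" by metis
next
  assume "hproj h - hproj g - w \<in> hproj ` \<Gamma>"
  then show "(hcoset \<Gamma> g, hcoset \<Gamma> h) \<in> layer w" unfolding layer_def by blast
qed

lemma layer_preimage:
  "{(g, h). (hcoset \<Gamma> g, hcoset \<Gamma> h) \<in> layer w} = {p. hdiff p - w \<in> hproj ` \<Gamma>}"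
  unfolding mem_layer_iff by (auto simp: hdiff_def)

lemma closed_proj: "closed (hproj ` \<Gamma>)"
proof -
  obtain e where e: "e > 0" "\<And>u. u \<in> hproj ` \<Gamma> \<Longrightarrow> norm u < e \<Longrightarrow> u = 0"
    using proj_small_eq_0 by blast
  show ?thesis
  proof (rule discrete_imp_closed[OF e(1)], intro ballI impI)
    fix u w assume "u \<in> hproj ` \<Gamma>" "w \<in> hproj ` \<Gamma>" "dist w u < e"
    then have "w - u = 0" by (intro e(2) proj_diff) (simp_all add: dist_norm)
    then show "w = u" by simp
  qed
qed

text \<open>The preimage is a union of parallel translates of the kernel of \<open>hdiff\<close>,
  kept apart by the discreteness of \<Gamma>'. The neighbourhood U of p meets only the translate
  through p, so a translation straightens it.\<close>

lemma submanifold_layer: "submanifold_pos_codim {p. hdiff p - w \<in> hproj ` \<Gamma>}"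
  unfolding submanifold_pos_codim_def
proof
  let ?P = "{p. hdiff p - w \<in> hproj ` \<Gamma>}"
  fix p assume p: "p \<in> ?P"
  obtain e where e: "e > 0" "\<And>u. u \<in> hproj ` \<Gamma> \<Longrightarrow> norm u < e \<Longrightarrow> u = 0"
    using proj_small_eq_0 by blast
  have diff: "hdiff (x - y) = hdiff x - hdiff y" and add: "hdiff (x + y) = hdiff x + hdiff y" for x y :: "'n heis \<times> 'n heis"
    by (rule linear_diff[OF linear_hdiff], rule linear_add[OF linear_hdiff])
  define U where "U = {q. norm (hdiff q - hdiff p) < e}"
  define V where "V = {x :: 'n heis \<times> 'n heis. norm (hdiff x) < e}"
  define L where "L = {x :: 'n heis \<times> 'n heis. hdiff x = 0}"
  have "open U" "open V"
    unfolding U_def V_def by (intro open_Collect_less continuous_intros)+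
  moreover have "p \<in> U" using e(1) by (simp add: U_def)
  moreover have "smooth_on U (\<lambda>x. x + - p)" "smooth_on V (\<lambda>x. x + p)"
    by (rule smooth_on_translation)+
  moreover have im: "(\<lambda>x. x + - p) ` U = V" "(\<lambda>x. x + p) ` V = U"
  proof -
    have "x + - p \<in> V" if "x \<in> U" for x using that by (simp add: U_def V_def diff)
    moreover have "x + p \<in> U" if "x \<in> V" for x using that by (simp add: U_def V_def add)
    moreover have "x = (x + - p) + p" "x = (x + p) + - p" for x by simp_all
    ultimately show "(\<lambda>x. x + - p) ` U = V" "(\<lambda>x. x + p) ` V = U" by (blast intro: image_eqI)+
  qed
  moreover have "subspace L"
    unfolding L_def by (rule linear_subspace_kernel[OF linear_hdiff])
  moreover have "L \<noteq> UNIV"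
  proof
    assume L: "L = UNIV"
    obtain x :: "'n heis \<times> 'n heis" where x: "hdiff x = (1, 0)" using hdiff_surj by blast
    have "x \<in> L" using L by simp
    then show False by (simp add: L_def x zero_prod_def)
  qed
  moreover have "(\<lambda>x. x + - p) ` (?P \<inter> U) = V \<inter> L"
  proof -
    have "q \<in> ?P \<longleftrightarrow> q + - p \<in> L" if "q \<in> U" for q
    proof
      assume "q \<in> ?P"
      then have "(hdiff q - w) - (hdiff p - w) \<in> hproj ` \<Gamma>" using p proj_diff by blast
      then have "hdiff q - hdiff p \<in> hproj ` \<Gamma>" by simp
      then have "hdiff q - hdiff p = 0" using that unfolding U_def by (intro e(2)) auto
      then show "q + - p \<in> L" by (simp add: L_def diff)
    next
      assume "q + - p \<in> L"
      then show "q \<in> ?P" using p by (simp add: L_def diff)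
    qed
    then have "?P \<inter> U = {q \<in> U. q + - p \<in> L}" by blast
    then show ?thesis using im(1) by blast
  qed
  ultimately have chart: "open U \<and> p \<in> U \<and> open V \<and> smooth_on U (\<lambda>x. x + - p) \<and> smooth_on V (\<lambda>x. x + p)
      \<and> (\<lambda>x. x + - p) ` U = V \<and> (\<lambda>x. x + p) ` V = U
      \<and> (\<forall>x\<in>U. (x + - p) + p = x) \<and> (\<forall>y\<in>V. (y + p) + - p = y)
      \<and> subspace L \<and> L \<noteq> UNIV \<and> (\<lambda>x. x + - p) ` (?P \<inter> U) = V \<inter> L"
    by simp
  show "\<exists>U V L. \<exists>\<phi> \<psi> :: 'n heis \<times> 'n heis \<Rightarrow> 'n heis \<times> 'n heis. open U \<and> p \<in> U \<and> open V \<and> smooth_on U \<phi> \<and> smooth_on V \<psi>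
      \<and> \<phi> ` U = V \<and> \<psi> ` V = U \<and> (\<forall>x\<in>U. \<psi> (\<phi> x) = x) \<and> (\<forall>y\<in>V. \<phi> (\<psi> y) = y)
      \<and> subspace L \<and> L \<noteq> UNIV \<and> \<phi> ` (?P \<inter> U) = V \<inter> L"
    by (rule exI[of _ U], rule exI[of _ V], rule exI[of _ L], rule exI[of _ "\<lambda>x. x + - p"],
        rule exI[of _ "\<lambda>x. x + p"], rule chart)
qed

lemma closed_submanifold_layer: "closed_submanifold_MM_pos_codim \<Gamma> (layer w)"
proof -
  have "layer w \<subseteq> Mset \<Gamma> \<times> Mset \<Gamma>" unfolding layer_def by auto
  moreover have "closed ((\<lambda>p. hdiff p - w) -` (hproj ` \<Gamma>))"
    by (intro closed_vimage closed_proj continuous_intros)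
  then have "closed {(g, h). (hcoset \<Gamma> g, hcoset \<Gamma> h) \<in> layer w}"
    unfolding layer_preimage vimage_def .
  ultimately show ?thesis
    unfolding closed_submanifold_MM_pos_codim_def layer_preimage
    using closedin_Mtop_prodI[OF subgroup, of "layer w"] submanifold_layer
    by (simp add: layer_preimage)
qed

lemma blockable_pairs_eq_UN_layer: "blockable_pairs \<Gamma> = \<Union>(layer ` rat_vecs)"
proof (rule set_eqI)
  fix p
  show "p \<in> blockable_pairs \<Gamma> \<longleftrightarrow> p \<in> \<Union>(layer ` rat_vecs)"
  proof (cases "p \<in> Mset \<Gamma> \<times> Mset \<Gamma>")
    case True
    then obtain g h where p: "p = (hcoset \<Gamma> g, hcoset \<Gamma> h)"
      by (metis Mset_cases mem_Sigma_iff prod.exhaust)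
    have "hproj h - hproj g \<in> rat_vecs" if "w \<in> rat_vecs" "hproj h - hproj g - w \<in> hproj ` \<Gamma>" for w
      using rat_vecs_add[OF that(1) proj_rat_vecs[OF that(2)]] by simp
    moreover have "hproj h - hproj g - (hproj h - hproj g) \<in> hproj ` \<Gamma>" using proj_0 by simp
    ultimately show ?thesis
      unfolding p mem_blockable_pairs_iff UN_iff mem_layer_iff by blast
  next
    case False
    then show ?thesis unfolding blockable_pairs_def layer_def by auto
  qed
qed

section \<open>The blockable pairs form a null set\<close>

lemma ex_nonzero_proj: obtains u where "u \<in> hproj ` \<Gamma>" "u \<noteq> 0"
proof -
  have "\<not> B \<subseteq> {0}"
  proof
    assume "B \<subseteq> {0}"
    then have "span B \<subseteq> {0}" by (metis span_mono span_insert_0 span_empty)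
    then have "((1, 0) :: (real^'n) \<times> (real^'n)) \<in> {0}" using B_span by blast
    then show False by (simp add: zero_prod_def)
  qed
  then show thesis using B_sub that by blast
qed

text \<open>The function \<open>f\<close> below is a circle-valued character of the torus quotient of the nilmanifold;
  its fibres are null because translations permute them transitively.\<close>

lemma AE_not_blockable:
  assumes \<mu>: "Hinv_prob \<Gamma> \<mu>"
  shows "AE p in \<mu> \<Otimes>\<^sub>M \<mu>. \<not> blockable \<Gamma> (fst p) (snd p)"
proof -
  interpret M: prob_space \<mu> using \<mu> by (simp add: Hinv_prob_def)
  interpret MM: pair_prob_space \<mu> \<mu> ..
  have space: "space \<mu> = Mset \<Gamma>"
    and sets: "sets \<mu> = {A. A \<subseteq> Mset \<Gamma> \<and> {g. hcoset \<Gamma> g \<in> A} \<in> sets borel}"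
    and inv: "\<And>g A. A \<in> sets \<mu> \<Longrightarrow> emeasure \<mu> (act g ` A) = emeasure \<mu> A"
    using \<mu> unfolding Hinv_prob_def by blast+
  \<comment> \<open>A single nonzero u suffices: blockability forces the pairing of the difference
    with this u to be rational in units of \<delta>, and that alone is a null condition.\<close>
  obtain u where u: "u \<in> hproj ` \<Gamma>" "u \<noteq> 0" using ex_nonzero_proj .
  define ch where "ch v = wedge v u / \<delta>" for v
  have ch_add: "ch (v + w) = ch v + ch w" for v w by (simp add: ch_def add_divide_distrib)
  have ch_surj: "\<exists>v. ch v = c" for c
  proof -
    obtain b where b: "wedge b u \<noteq> 0"
      using wedge_eq_0_span[OF B_span, of u] u(2) wedge_skew[of u] by (metis neg_equal_0_iff_equal)
    then have "ch ((c * \<delta> / wedge b u) *\<^sub>R b) = c" using \<delta>_pos by (simp add: ch_def)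
    then show ?thesis by blast
  qed
  \<comment> \<open>The chosen representative does not matter: \<open>ch\<close> is integral on
    \<Gamma>', so its fractional part is constant on cosets.\<close>
  define f where "f m = frac (ch (hproj (SOME g. m = hcoset \<Gamma> g)))" for m
  have f: "f (hcoset \<Gamma> g) = frac (ch (hproj g))" for g
  proof -
    define g' where "g' = (SOME g'. hcoset \<Gamma> g = hcoset \<Gamma> g')"
    have "hcoset \<Gamma> g = hcoset \<Gamma> g'" unfolding g'_def by (rule someI[of _ g]) simp
    then have "ch (hproj g' - hproj g) \<in> \<int>"
      unfolding ch_def by (intro wedge_proj_Ints hcoset_eq_imp_proj_diff u(1))
    then obtain k where "ch (hproj g' - hproj g) = of_int k" by (auto elim: Ints_cases)
    then have "ch (hproj g') = ch (hproj g) + of_int k"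
      using ch_add[of "hproj g' - hproj g" "hproj g"] by simp
    then show ?thesis unfolding f_def g'_def[symmetric] by simp
  qed
  have f_meas [measurable]: "f \<in> borel_measurable \<mu>"
  proof (rule measurableI)
    fix A :: "real set" assume A: "A \<in> sets borel"
    have "(\<lambda>g. ch (hproj g)) \<in> borel_measurable borel"
      unfolding ch_def using \<delta>_pos by (intro borel_measurable_continuous_onI continuous_intros) auto
    then have "(\<lambda>g. frac (ch (hproj g))) \<in> borel_measurable borel"
      unfolding frac_def by measurable
    from measurable_sets[OF this A]
    have "{g. hcoset \<Gamma> g \<in> f -` A \<inter> space \<mu>} \<in> sets borel"
      by (simp add: space f vimage_def)
    then show "f -` A \<inter> space \<mu> \<in> sets \<mu>" unfolding sets space by blast
  qed simp
  define lev where "lev c = {m \<in> space \<mu>. f m = frac c}" for c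
  have lev_sets: "lev c \<in> sets \<mu>" for c unfolding lev_def by measurable
  have lev_act: "emeasure \<mu> (lev d) = emeasure \<mu> (lev c)" for c d
  proof -
    obtain v where v: "ch v = d - c" using ch_surj by blast
    have shift: "act (hel w 0) m \<in> lev (x + ch w)" if m: "m \<in> lev x" for w m x
    proof -
      have "m \<in> Mset \<Gamma>" using m by (simp add: lev_def space)
      then obtain g where g: "m = hcoset \<Gamma> g" by (rule Mset_cases)
      have "frac (ch (hproj g)) = frac x" using m g by (simp add: lev_def f)
      then have "frac (ch w + ch (hproj g)) = frac (x + ch w)"
        by (simp add: frac_add add.commute)
      then show ?thesis by (simp add: lev_def g f space ch_add)
    qed
    have "act (hel v 0) ` lev c = lev d"
    proof
      show "act (hel v 0) ` lev c \<subseteq> lev d" using shift[of _ c v] v by auto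
      show "lev d \<subseteq> act (hel v 0) ` lev c"
      proof
        fix m assume "m \<in> lev d"
        have "ch (- v) = c - d" using v by (simp add: ch_def)
        then have "act (hel (- v) 0) m \<in> lev c" using shift[OF \<open>m \<in> lev d\<close>, of "- v"] by simp
        moreover have "m = act (hel v 0) (act (hel (- v) 0) m)"
          by (simp add: hel_mult flip: hone_hel)
        ultimately show "m \<in> act (hel v 0) ` lev c" by (rule image_eqI[rotated])
      qed
    qed
    then show ?thesis using inv[OF lev_sets, of "hel v 0" c] by simp
  qed
  have lev_null: "emeasure \<mu> (lev c) = 0" for c
  \<comment> \<open>The numbers 1 / (n + 2) are infinitely many distinct elements of (0,1), each
    equal to its own fractional part, so their fibres are pairwise disjoint.\<close>
  proof (rule infinite_disjoint_emeasure_eq_0[of UNIV "\<lambda>n::nat. lev (1 / real (n + 2))"])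
    have "frac (1 / real (n + 2)) = 1 / real (n + 2)" for n
      by (simp add: frac_eq field_simps)
    then show "disjoint_family (\<lambda>n. lev (1 / real (n + 2)))"
      by (auto simp: disjoint_family_on_def lev_def)
    show "emeasure \<mu> (\<Union>n. lev (1 / real (n + 2))) < \<infinity>"
      by (simp add: M.emeasure_eq_measure)
  qed (use lev_act lev_sets in auto)
  \<comment> \<open>The exceptional m lie in countably many null fibres, one for each rational shift
    of \<open>f m'\<close>.\<close>
  have "AE m in \<mu>. f m - f m' \<notin> \<rat>" for m'
  proof -
    have "(\<Union>q\<in>\<rat>. lev (f m' + q)) \<in> null_sets \<mu>"
      using lev_null lev_sets by (intro null_sets_UN' countable_rat) auto
    moreover have "{m \<in> space \<mu>. \<not> f m - f m' \<notin> \<rat>} \<subseteq> (\<Union>q\<in>\<rat>. lev (f m' + q))"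
    proof
      fix m assume m: "m \<in> {m \<in> space \<mu>. \<not> f m - f m' \<notin> \<rat>}"
      have "frac (f m) = f m" by (simp add: f_def)
      then have "m \<in> lev (f m' + (f m - f m'))" using m by (simp add: lev_def)
      then show "m \<in> (\<Union>q\<in>\<rat>. lev (f m' + q))" using m by blast
    qed
    ultimately show ?thesis by (rule AE_I'[rotated, rotated])
  qed
  then have "AE m in \<mu>. AE m' in \<mu>. f (snd (m, m')) - f (fst (m, m')) \<notin> \<rat>" by simp
  \<comment> \<open>Passing to the product measure needs a measurable condition. Irrationality of
    the difference of f is one, and it implies that the pair is not blockable.\<close>
  moreover have "{p \<in> space (\<mu> \<Otimes>\<^sub>M \<mu>). f (snd p) - f (fst p) \<notin> \<rat>} \<in> sets (\<mu> \<Otimes>\<^sub>M \<mu>)"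
  proof -
    have [measurable]: "(\<rat> :: real set) \<in> sets borel"
      by (rule sets.countable[OF _ countable_rat]) simp
    show ?thesis by measurable
  qed
  ultimately have "AE p in \<mu> \<Otimes>\<^sub>M \<mu>. f (snd p) - f (fst p) \<notin> \<rat>"
    by (intro MM.AE_pair_measure)
  then show ?thesis
  proof (rule AE_mp, intro AE_I2 impI notI)
    fix p assume p: "p \<in> space (\<mu> \<Otimes>\<^sub>M \<mu>)" and irr: "f (snd p) - f (fst p) \<notin> \<rat>"
      and bl: "blockable \<Gamma> (fst p) (snd p)"
    have "fst p \<in> Mset \<Gamma>" "snd p \<in> Mset \<Gamma>" using p by (auto simp: space_pair_measure space)
    then obtain g h where gh: "fst p = hcoset \<Gamma> g" "snd p = hcoset \<Gamma> h" by (metis Mset_cases)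
    have "hproj h - hproj g \<in> rat_vecs" using bl unfolding gh blockable_iff_rat_vecs .
    then have "ch (hproj h - hproj g) \<in> \<rat>" using u(1) unfolding rat_vecs_def ch_def by blast
    then have "ch (hproj h) - ch (hproj g) \<in> \<rat>" by (simp add: ch_def diff_divide_distrib)
    then have "(ch (hproj h) - ch (hproj g)) - of_int \<lfloor>ch (hproj h)\<rfloor> + of_int \<lfloor>ch (hproj g)\<rfloor> \<in> \<rat>"
      by (rule Rats_add[OF Rats_diff[OF _ Rats_of_int] Rats_of_int])
    then show False using irr by (simp add: gh f frac_def algebra_simps)
  qed
qed

end

theorem theorem5p4:
  fixes \<Gamma> :: "'n::finite heis set"
  assumes "lattice \<Gamma>"
  shows "(\<forall>m1\<in>Mset \<Gamma>. \<forall>m2\<in>Mset \<Gamma>. blockable \<Gamma> m1 m2 \<longleftrightarrow> midpoint_blockable m1 m2)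
    \<and> (\<forall>m\<in>Mset \<Gamma>. blockable \<Gamma> m m)
    \<and> (prod_topology (Mtop \<Gamma>) (Mtop \<Gamma>)) closure_of (blockable_pairs \<Gamma>) = Mset \<Gamma> \<times> Mset \<Gamma>
    \<and> (\<exists>\<S>. countable \<S> \<and> (\<forall>S\<in>\<S>. closed_submanifold_MM_pos_codim \<Gamma> S) \<and> \<Union>\<S> = blockable_pairs \<Gamma>)
    \<and> (\<forall>\<mu>. Hinv_prob \<Gamma> \<mu> \<longrightarrow> (AE p in \<mu> \<Otimes>\<^sub>M \<mu>. \<not> blockable \<Gamma> (fst p) (snd p)))"
proof -
  obtain \<delta> B where "framed_lattice \<Gamma> \<delta> B" using lattice_imp_framed_lattice[OF assms] .
  then interpret framed_lattice \<Gamma> \<delta> B .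
  have "blockable \<Gamma> m1 m2 \<longleftrightarrow> midpoint_blockable m1 m2" if "m1 \<in> Mset \<Gamma>" "m2 \<in> Mset \<Gamma>" for m1 m2
    using that by (metis Mset_cases blockable_iff_rat_vecs midpoint_blockable_iff_rat_vecs)
  moreover have "blockable \<Gamma> m m" if "m \<in> Mset \<Gamma>" for m
    using that by (metis Mset_cases blockable_iff_rat_vecs diff_self rat_vecs_0)
  moreover have "\<exists>\<S>. countable \<S> \<and> (\<forall>S\<in>\<S>. closed_submanifold_MM_pos_codim \<Gamma> S) \<and> \<Union>\<S> = blockable_pairs \<Gamma>"
    using countable_rat_vecs closed_submanifold_layer blockable_pairs_eq_UN_layer
    by (intro exI[of _ "layer ` rat_vecs"]) auto
  ultimately show ?thesis using blockable_pairs_dense AE_not_blockable by blast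
qed

end
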